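(* Let $n\in\mathbb N$ and let $\boldsymbol\alpha=(\alpha_1,\alpha_2,\alpha_3)$ with $\alpha_i>-1$ for $i=1,2,3$. Write $e^{\boldsymbol k}_{\boldsymbol l}\equiv e^{\boldsymbol k}_{\boldsymbol l}(\boldsymbol\alpha,n)$ for the Bézier coefficients of the dual bivariate Bernstein polynomials, with $e^{\boldsymbol k}_{\boldsymbol l}:=0$ whenever $\boldsymbol k\notin\Theta_n$ or $\boldsymbol l\notin\Theta_n$. Put $\boldsymbol v_1:=(1,0)$, $\boldsymbol v_2:=(0,1)$. Then for all $\boldsymbol k,\boldsymbol l\in\Theta_n$, \[ \sigma_0(\boldsymbol k)\,e^{\boldsymbol k+\boldsymbol v_2}_{\boldsymbol l}-\sigma_1(\boldsymbol k)\,e^{\boldsymbol k}_{\boldsymbol l}+\sigma_2(\boldsymbol k)\,e^{\boldsymbol k-\boldsymbol v_2}_{\boldsymbol l} =\sigma_0(\boldsymbol l)\,e^{\boldsymbol k}_{\boldsymbol l+\boldsymbol v_2}-\sigma_1(\boldsymbol l)\,e^{\boldsymbol k}_{\boldsymbol l}+\sigma_2(\boldsymbol l)\,e^{\boldsymbol k}_{\boldsymbol l-\boldsymbol v_2}, \] \[ \tau_0(\boldsymbol k)\,e^{\boldsymbol k+\boldsymbol v_1}_{\boldsymbol l}-\tau_1(\boldsymbol k)\,e^{\boldsymbol k}_{\boldsymbol l}+\tau_2(\boldsymbol k)\,e^{\boldsymbol k-\boldsymbol v_1}_{\boldsymbol l} =\tau_0(\boldsymbol l)\,e^{\boldsymbol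 k}_{\boldsymbol l+\boldsymbol v_1}-\tau_1(\boldsymbol l)\,e^{\boldsymbol k}_{\boldsymbol l}+\tau_2(\boldsymbol l)\,e^{\boldsymbol k}_{\boldsymbol l-\boldsymbol v_1}, \] where for $\boldsymbol t=(t_1,t_2)$ and $i=0,1,2$ we set $\sigma_i(\boldsymbol t):=\varphi_i(\boldsymbol\alpha,\boldsymbol t)$ and $\tau_i(\boldsymbol t):=\varphi_i(\tilde{\boldsymbol\alpha},\tilde{\boldsymbol t})$, with $\tilde{\boldsymbol\alpha}:=(\alpha_2,\alpha_1,\alpha_3)$, $\tilde{\boldsymbol t}:=(t_2,t_1)$, and \[ \varphi_0(\boldsymbol\alpha,\boldsymbol t):=(|\boldsymbol t|-n)(t_2+\alpha_2+1),\quad \varphi_2(\boldsymbol\alpha,\boldsymbol t):=t_2(|\boldsymbol t|-\alpha_3-n-1),\quad \varphi_1(\boldsymbol\alpha,\boldsymbol t):=\varphi_0(\boldsymbol\alpha,\boldsymbol t)+\varphi_2(\boldsymbol\alpha,\boldsymbol t). \]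
   Context: $\mathbb N$ includes $0$. For a vector $\boldsymbol y$, $|\boldsymbol y|$ denotes the sum of its components. $\Theta_n:=\{(k_1,k_2)\in\mathbb N^2: 0\le k_1+k_2\le n\}$. $T:=\{(x_1,x_2): x_1,x_2\ge0,\ x_1+x_2\le1\}$, and $\Pi_n^2$ is the space of bivariate real polynomials of total degree at most $n$. The bivariate Bernstein basis of $\Pi^2_n$ is \[B^n_{\boldsymbol k}(\boldsymbol x):=\frac{n!}{k_1!k_2!(n-|\boldsymbol k|)!}x_1^{k_1}x_2^{k_2}(1-|\boldsymbol x|)^{n-|\boldsymbol k|},\qquad \boldsymbol k\in\Theta_n.\] The inner product is $\langle f,g\rangle_{\boldsymbol\alpha}:=\iint_T w_{\boldsymbol\alpha}(\boldsymbol x)f(\boldsymbol x)g(\boldsymbol x)\,d\boldsymbol x$, with $w_{\boldsymbol\alpha}(\boldsymbol x):=A_{\boldsymbol\alpha}x_1^{\alpha_1}x_2^{\alpha_2}(1-|\boldsymbol x|)^{\alpha_3}$ and $A_{\boldsymbol\alpha}:=\Gamma(|\boldsymbol\alpha|+3)\prod_{i=1}^3\Gamma(\alpha_i+1)^{-1}$. The dual bivariate Bernstein polynomials $D^n_{\boldsymbol k}(\cdot;\boldsymbol\alpha)\in\Pi^2_n$, $\boldsymbol k\in\Theta_n$, are defined by $\langle D^n_{\boldsymbol k},B^n_{\boldsymbol l}\rangle_{\boldsymbol\alpha}=\delta_{\boldsymbol k,\boldsymbol l}$ for $\boldsymbol k,\boldsymbol l\in\Theta_n$. Their Bézier coefficients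 $e^{\boldsymbol k}_{\boldsymbol l}(\boldsymbol\alpha,n)$ are defined by $D^n_{\boldsymbol k}(\boldsymbol x;\boldsymbol\alpha)=\sum_{\boldsymbol l\in\Theta_n}e^{\boldsymbol k}_{\boldsymbol l}(\boldsymbol\alpha,n)B^n_{\boldsymbol l}(\boldsymbol x)$, $\boldsymbol k\in\Theta_n$. *)

theory Defs
  imports "HOL-Analysis.Analysis"
begin

text \<open>Multi-indices are pairs of integers, so that shifted indices such as \<open>k - (0, 1)\<close> make sense
  even when they leave \<open>Theta n\<close>; the elements of \<open>Theta n\<close> itself have natural components.\<close>

definition Theta :: "nat \<Rightarrow> (int \<times> int) set" where
  "Theta n = {(k1, k2). 0 \<le> k1 \<and> 0 \<le> k2 \<and> k1 + k2 \<le> int n}"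

definition triangle :: "(real \<times> real) set" where
  "triangle = {(x1, x2). 0 \<le> x1 \<and> 0 \<le> x2 \<and> x1 + x2 \<le> 1}"

text \<open>Bivariate polynomials are represented by the functions they induce on the plane.\<close>

definition Pi2 :: "nat \<Rightarrow> (real \<times> real \<Rightarrow> real) set" where
  "Pi2 n = {p. \<exists>c :: int \<times> int \<Rightarrow> real.
     p = (\<lambda>(x1, x2). \<Sum>(i, j)\<in>Theta n. c (i, j) * x1 ^ nat i * x2 ^ nat j)}"

fun bernstein :: "nat \<Rightarrow> int \<times> int \<Rightarrow> real \<times> real \<Rightarrow> real" where
  "bernstein n (k1, k2) (x1, x2) =
     fact n / (fact (nat k1) * fact (nat k2) * fact (nat (int n - (k1 + k2)))) *
     x1 ^ nat k1 * x2 ^ nat k2 * (1 - (x1 + x2)) ^ nat (int n - (k1 + k2))"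

text \<open>Note \<open>0 powr 0 = 0\<close>: for vanishing exponents the weight below differs from the usual one, but
  only on the boundary of the triangle, which is a null set.\<close>

fun weight :: "real \<times> real \<times> real \<Rightarrow> real \<times> real \<Rightarrow> real" where
  "weight (\<alpha>1, \<alpha>2, \<alpha>3) (x1, x2) =
     Gamma (\<alpha>1 + \<alpha>2 + \<alpha>3 + 3) / (Gamma (\<alpha>1 + 1) * Gamma (\<alpha>2 + 1) * Gamma (\<alpha>3 + 1)) *
     x1 powr \<alpha>1 * x2 powr \<alpha>2 * (1 - (x1 + x2)) powr \<alpha>3"

definition inner_prod ::
  "real \<times> real \<times> real \<Rightarrow> (real \<times> real \<Rightarrow> real) \<Rightarrow> (real \<times> real \<Rightarrow> real) \<Rightarrow> real" where
  "inner_prod \<alpha> f g = (LINT x:triangle|lborel. weight \<alpha> x * f x * g x)"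

text \<open>The descriptions below are proper for \<open>k \<in> Theta n\<close> and \<open>\<alpha>1, \<alpha>2, \<alpha>3 > -1\<close>, since then
  \<open>inner_prod \<alpha>\<close> is positive definite on \<open>Pi2 n\<close> and the \<open>bernstein n l\<close> form a basis of it.\<close>

definition dual_bernstein ::
  "nat \<Rightarrow> real \<times> real \<times> real \<Rightarrow> int \<times> int \<Rightarrow> real \<times> real \<Rightarrow> real" where
  "dual_bernstein n \<alpha> k =
     (THE p. p \<in> Pi2 n \<and>
        (\<forall>l\<in>Theta n. inner_prod \<alpha> p (bernstein n l) = (if k = l then 1 else 0)))"

text \<open>In \<open>bezier_coeff n \<alpha> k l\<close>, \<open>k\<close> is the upper and \<open>l\<close> the lower index. The condition \<open>c l = 0\<close>
  outside \<open>Theta n\<close> both makes the coefficient family unique and implements the zero extension.\<close>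

definition bezier_coeff ::
  "nat \<Rightarrow> real \<times> real \<times> real \<Rightarrow> int \<times> int \<Rightarrow> int \<times> int \<Rightarrow> real" where
  "bezier_coeff n \<alpha> k =
     (if k \<in> Theta n
      then (THE c. (\<forall>x. dual_bernstein n \<alpha> k x = (\<Sum>l\<in>Theta n. c l * bernstein n l x)) \<and>
                   (\<forall>l. l \<notin> Theta n \<longrightarrow> c l = 0))
      else (\<lambda>l. 0))"

fun phi0 :: "nat \<Rightarrow> real \<times> real \<times> real \<Rightarrow> int \<times> int \<Rightarrow> real" where
  "phi0 n (\<alpha>1, \<alpha>2, \<alpha>3) (t1, t2) =
     (of_int (t1 + t2) - real n) * (of_int t2 + \<alpha>2 + 1)"

fun phi2 :: "nat \<Rightarrow> real \<times> real \<times> real \<Rightarrow> int \<times> int \<Rightarrow> real" where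
  "phi2 n (\<alpha>1, \<alpha>2, \<alpha>3) (t1, t2) =
     of_int t2 * (of_int (t1 + t2) - \<alpha>3 - real n - 1)"

definition phi1 :: "nat \<Rightarrow> real \<times> real \<times> real \<Rightarrow> int \<times> int \<Rightarrow> real" where
  "phi1 n \<alpha> t = phi0 n \<alpha> t + phi2 n \<alpha> t"

abbreviation sigma0 :: "nat \<Rightarrow> real \<times> real \<times> real \<Rightarrow> int \<times> int \<Rightarrow> real" where
  "sigma0 n \<alpha> t \<equiv> phi0 n \<alpha> t"
abbreviation sigma1 :: "nat \<Rightarrow> real \<times> real \<times> real \<Rightarrow> int \<times> int \<Rightarrow> real" where
  "sigma1 n \<alpha> t \<equiv> phi1 n \<alpha> t"
abbreviation sigma2 :: "nat \<Rightarrow> real \<times> real \<times> real \<Rightarrow> int \<times> int \<Rightarrow> real" where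
  "sigma2 n \<alpha> t \<equiv> phi2 n \<alpha> t"

fun swap12 :: "real \<times> real \<times> real \<Rightarrow> real \<times> real \<times> real" where
  "swap12 (\<alpha>1, \<alpha>2, \<alpha>3) = (\<alpha>2, \<alpha>1, \<alpha>3)"

definition tau0 :: "nat \<Rightarrow> real \<times> real \<times> real \<Rightarrow> int \<times> int \<Rightarrow> real" where
  "tau0 n \<alpha> t = phi0 n (swap12 \<alpha>) (prod.swap t)"

definition tau1 :: "nat \<Rightarrow> real \<times> real \<times> real \<Rightarrow> int \<times> int \<Rightarrow> real" where
  "tau1 n \<alpha> t = phi1 n (swap12 \<alpha>) (prod.swap t)"

definition tau2 :: "nat \<Rightarrow> real \<times> real \<times> real \<Rightarrow> int \<times> int \<Rightarrow> real" where
  "tau2 n \<alpha> t = phi2 n (swap12 \<alpha>) (prod.swap t)"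

end

theory Submission
  imports Defs
begin

text \<open>
  Let \<open>G\<close> be the Gram matrix of the Bernstein basis. The dual polynomial with upper index \<open>k\<close> has
  as its Bezier coefficients the \<open>k\<close>-th row of a left inverse \<open>e\<close> of \<open>G\<close>, so both recurrences are
  identities about \<open>e = G\<^sup>-\<^sup>1\<close>. Write the first one with the matrix \<open>M\<close> that has the coefficients
  \<open>\<sigma>\<^sub>0\<close>, \<open>-\<sigma>\<^sub>1\<close>, \<open>\<sigma>\<^sub>2\<close> on the three diagonals belonging to the shifts of the second index: it says
  \<open>M e = e M\<^sup>T\<close>. Multiplying by \<open>G\<close> from both sides turns this into \<open>G M = M\<^sup>T G\<close>; as \<open>G\<close> is symmetric,
  this means that \<open>G M\<close> is a symmetric matrix, i.e. that the operator sending the \<open>l\<close>-th Bernstein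
  polynomial to the combination with the coefficients in column \<open>l\<close> of \<open>M\<close> is self-adjoint
  (\<open>self_adjoint_imp_inverse_intertwines\<close>).

  The symmetry of \<open>G M\<close> is checked on the entries of \<open>G\<close>, which are Dirichlet integrals over the
  triangle and hence quotients of Gamma values (\<open>dirichlet_integral\<close>, \<open>gram_nat\<close>). A shift of an
  index multiplies such an entry by an elementary rational factor (\<open>gram_shift\<close>), and what remains is
  a polynomial identity (\<open>gram_shift_self_adjoint\<close>).

  For \<open>e\<close> to be the inverse of \<open>G\<close>, the descriptions defining the dual polynomials and their
  coefficients have to be met by exactly one object. This rests on three facts: the Bernstein
  polynomials of degree \<open>n\<close> span all polynomials of degree at most \<open>n\<close> (\<open>Pi2_eq_bernstein_span\<close>),
  they are linearly independent even as functions on the interior of the triangle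
  (\<open>bernstein_independent\<close>), and therefore the quadratic form of \<open>G\<close> vanishes only at \<open>0\<close>
  (\<open>gram_anisotropic\<close>).

  The second recurrence is the first one after the exchange of the two variables, under which the
  Bezier coefficients are invariant (\<open>bezier_coeff_swap\<close>).
\<close>

section \<open>Matrices over a finite index set\<close>

text \<open>
  Matrices are functions of two indices, of which only the values on \<open>S\<close> matter. This allows index
  sets such as \<open>Theta n\<close> whose size depends on a variable.
\<close>

definition left_inverse_on :: "'i set \<Rightarrow> ('i \<Rightarrow> 'i \<Rightarrow> real) \<Rightarrow> ('i \<Rightarrow> 'i \<Rightarrow> real) \<Rightarrow> bool" where
  "left_inverse_on S E G \<longleftrightarrow> (\<forall>k\<in>S. \<forall>l\<in>S. (\<Sum>m\<in>S. E k m * G m l) = (if k = l then 1 else 0))"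

text \<open>
  The absence of nonzero isotropic vectors is the consequence of positive definiteness on
  which inversion rests. In contrast to a trivial kernel it passes to principal submatrices, so that
  induction on the index set is possible.
\<close>

definition anisotropic_on :: "'i set \<Rightarrow> ('i \<Rightarrow> 'i \<Rightarrow> real) \<Rightarrow> bool" where
  "anisotropic_on S G \<longleftrightarrow>
     (\<forall>c. (\<Sum>k\<in>S. \<Sum>l\<in>S. c k * G k l * c l) = 0 \<longrightarrow> (\<forall>k\<in>S. c k = 0))"

lemma anisotropic_onD:
  assumes "anisotropic_on S G" "(\<Sum>k\<in>S. \<Sum>l\<in>S. c k * G k l * c l) = 0" "k \<in> S"
  shows "c k = 0"
  using assms unfolding anisotropic_on_def by fast

lemma anisotropic_on_insertD:
  assumes "finite S" "s \<notin> S" "anisotropic_on (insert s S) G"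
  shows "anisotropic_on S G"
  unfolding anisotropic_on_def
proof (intro allI impI ballI)
  fix c k
  assume 0: "(\<Sum>k\<in>S. \<Sum>l\<in>S. c k * G k l * c l) = 0" and "k \<in> S"
  let ?c = "c(s := 0)"
  have "(\<Sum>k\<in>insert s S. \<Sum>l\<in>insert s S. ?c k * G k l * ?c l)
      = (\<Sum>k\<in>S. \<Sum>l\<in>S. ?c k * G k l * ?c l)"
    using assms by simp
  also have "\<dots> = (\<Sum>k\<in>S. \<Sum>l\<in>S. c k * G k l * c l)"
    using assms by (intro sum.cong refl) auto
  finally have "?c k = 0"
    using 0 \<open>k \<in> S\<close> by (intro anisotropic_onD[OF assms(3), of ?c]) simp_all
  then show "c k = 0"
    using \<open>k \<in> S\<close> \<open>s \<notin> S\<close> by (auto split: if_splits)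
qed

text \<open>
  Gram-Schmidt orthogonalisation in terms of matrices. For a new index \<open>s\<close>, the vector \<open>r\<close> is the
  basis vector \<open>s\<close> minus its projection to the span of the old ones: it is orthogonal to every old
  index, and as \<open>r s = 1\<close>, anisotropy makes its pairing with \<open>s\<close> nonzero. After scaling it is the dual
  vector of \<open>s\<close>, and subtracting multiples of it corrects the old dual vectors.
\<close>

lemma anisotropic_left_inverse_exists:
  assumes "finite S" "anisotropic_on S G"
  shows "\<exists>E. left_inverse_on S E G"
  using assms
proof (induction S rule: finite_induct)
  case empty
  show ?case by (simp add: left_inverse_on_def)
next
  case (insert s S)
  then obtain E where E: "left_inverse_on S E G"
    using anisotropic_on_insertD[OF insert.hyps insert.prems] by blast
  have EG: "(\<Sum>m\<in>S. E k m * G m l) = (if k = l then 1 else 0)" if "k \<in> S" "l \<in> S" for k l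
    using E that by (auto simp: left_inverse_on_def)
  define r where "r = (\<lambda>m. if m = s then 1 else - (\<Sum>t\<in>S. G s t * E t m))"
  \<comment> \<open>The row vector \<open>r G\<close>.\<close>
  define q where "q = (\<lambda>l. \<Sum>m\<in>insert s S. r m * G m l)"
  have q_split: "q l = G s l + (\<Sum>m\<in>S. r m * G m l)" for l
    using insert.hyps by (simp add: q_def r_def)
  have q_0: "q l = 0" if "l \<in> S" for l
  proof -
    have "(\<Sum>m\<in>S. r m * G m l) = (\<Sum>m\<in>S. - (\<Sum>t\<in>S. G s t * E t m) * G m l)"
      using insert.hyps by (intro sum.cong refl) (auto simp: r_def)
    also have "\<dots> = - (\<Sum>m\<in>S. \<Sum>t\<in>S. G s t * (E t m * G m l))"
      by (simp add: sum_negf sum_distrib_right mult.assoc)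
    also have "\<dots> = - (\<Sum>t\<in>S. G s t * (\<Sum>m\<in>S. E t m * G m l))"
      by (subst sum.swap) (simp add: sum_distrib_left)
    also have "\<dots> = - (\<Sum>t\<in>S. G s t * (if t = l then 1 else 0))"
      using that by (simp add: EG cong: sum.cong)
    also have "\<dots> = - G s l"
      using that insert.hyps by (simp add: if_distrib[of "\<lambda>u. _ * u"] cong: if_cong)
    finally show ?thesis by (simp add: q_split)
  qed
  have "q s \<noteq> 0"
  proof
    assume "q s = 0"
    then have q0: "q l = 0" if "l \<in> insert s S" for l
      using q_0 that by auto
    have "(\<Sum>k\<in>insert s S. \<Sum>l\<in>insert s S. r k * G k l * r l)
        = (\<Sum>l\<in>insert s S. q l * r l)"
      unfolding q_def by (subst sum.swap) (simp only: sum_distrib_right)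
    also have "\<dots> = 0" by (rule sum.neutral) (simp add: q0)
    finally have "r s = 0"
      using anisotropic_onD[OF insert.prems, of r s] by blast
    then show False by (simp add: r_def)
  qed
  define d where "d = (\<lambda>m. r m / q s)"
  have d_G: "(\<Sum>m\<in>insert s S. d m * G m l) = (if s = l then 1 else 0)" if "l \<in> insert s S" for l
  proof -
    have "(\<Sum>m\<in>insert s S. d m * G m l) = q l / q s"
      by (simp add: d_def q_def sum_divide_distrib)
    then show ?thesis using that q_0 \<open>q s \<noteq> 0\<close> insert.hyps by auto
  qed
  define E0 where "E0 = (\<lambda>k m. if m = s then 0 else E k m)"
  have E0_G: "(\<Sum>m\<in>insert s S. E0 k m * G m l) = (\<Sum>m\<in>S. E k m * G m l)" for k l
  proof -
    have "(\<Sum>m\<in>insert s S. E0 k m * G m l) = (\<Sum>m\<in>S. E0 k m * G m l)"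
      using insert.hyps by (simp add: E0_def)
    also have "\<dots> = (\<Sum>m\<in>S. E k m * G m l)"
      using insert.hyps by (intro sum.cong) (auto simp: E0_def)
    finally show ?thesis .
  qed
  define E' where
    "E' = (\<lambda>k m. if k = s then d m else E0 k m - (\<Sum>t\<in>S. E k t * G t s) * d m)"
  have "left_inverse_on (insert s S) E' G"
    unfolding left_inverse_on_def
  proof (intro ballI)
    fix k l assume kl: "k \<in> insert s S" "l \<in> insert s S"
    show "(\<Sum>m\<in>insert s S. E' k m * G m l) = (if k = l then 1 else 0)"
    proof (cases "k = s")
      case True
      then show ?thesis using d_G kl by (simp add: E'_def)
    next
      case False
      have "(\<Sum>m\<in>insert s S. E' k m * G m l)
          = (\<Sum>m\<in>insert s S. E0 k m * G m l)
            - (\<Sum>t\<in>S. E k t * G t s) * (\<Sum>m\<in>insert s S. d m * G m l)"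
        using False by (simp only: E'_def if_False left_diff_distrib sum_subtractf
            sum_distrib_left mult.assoc)
      also have "\<dots> = (\<Sum>m\<in>S. E k m * G m l)
            - (\<Sum>t\<in>S. E k t * G t s) * (if s = l then 1 else 0)"
        using kl by (simp only: E0_G d_G)
      also have "\<dots> = (if k = l then 1 else 0)"
        using False kl EG by auto
      finally show ?thesis .
    qed
  qed
  then show ?case by blast
qed

text \<open>
  The difference \<open>d\<close> of two rows with the same product with \<open>G\<close> satisfies \<open>d G = 0\<close>, in particular
  \<open>d G d\<^sup>T = 0\<close>.
\<close>

lemma anisotropic_left_inverse_unique:
  assumes "finite S" "anisotropic_on S G" "left_inverse_on S E G"
    and c: "\<And>l. l \<in> S \<Longrightarrow> (\<Sum>m\<in>S. c m * G m l) = (if k = l then 1 else 0)"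
    and "k \<in> S" "m \<in> S"
  shows "c m = E k m"
proof -
  let ?d = "\<lambda>m. c m - E k m"
  have "(\<Sum>i\<in>S. \<Sum>l\<in>S. ?d i * G i l * ?d l) = (\<Sum>l\<in>S. (\<Sum>i\<in>S. ?d i * G i l) * ?d l)"
    by (subst sum.swap) (simp only: sum_distrib_right)
  also have "\<dots> = 0"
  proof (rule sum.neutral, rule ballI)
    fix l assume "l \<in> S"
    then have "(\<Sum>i\<in>S. ?d i * G i l) = 0"
      using c assms(3,5) by (simp add: left_diff_distrib sum_subtractf left_inverse_on_def)
    then show "(\<Sum>i\<in>S. ?d i * G i l) * ?d l = 0" by simp
  qed
  finally have "?d m = 0"
    using anisotropic_onD[OF assms(2), of ?d m] assms(6) by blast
  then show ?thesis by simp
qed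

lemma sum_delta_mult:
  fixes f :: "'i \<Rightarrow> real"
  assumes "finite S" "k \<in> S"
  shows "(\<Sum>m\<in>S. (if k = m then 1 else 0) * f m) = f k"
    and "(\<Sum>m\<in>S. f m * (if m = k then 1 else 0)) = f k"
  using assms by (simp_all add: if_distrib[of "\<lambda>u. u * _"] if_distrib[of "\<lambda>u. _ * u"] cong: if_cong)

lemma sum_mult_assoc:
  fixes f :: "'i \<Rightarrow> real"
  shows "(\<Sum>m\<in>S. (\<Sum>i\<in>S. f i * A i m) * g m) = (\<Sum>i\<in>S. f i * (\<Sum>m\<in>S. A i m * g m))"
proof -
  have "(\<Sum>m\<in>S. (\<Sum>i\<in>S. f i * A i m) * g m) = (\<Sum>m\<in>S. \<Sum>i\<in>S. f i * (A i m * g m))"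
    by (simp add: sum_distrib_right mult.assoc)
  also have "\<dots> = (\<Sum>i\<in>S. f i * (\<Sum>m\<in>S. A i m * g m))"
    by (subst sum.swap) (simp add: sum_distrib_left)
  finally show ?thesis .
qed

text \<open>
  Evaluate \<open>E G E\<^sup>T\<close> in two ways; by the symmetry of \<open>G\<close>, \<open>G E\<^sup>T\<close> is the transpose of \<open>E G = 1\<close>.
\<close>

lemma left_inverse_sym:
  assumes fin: "finite S" and E: "left_inverse_on S E G"
    and sym: "\<And>k l. k \<in> S \<Longrightarrow> l \<in> S \<Longrightarrow> G k l = G l k"
    and k: "k \<in> S" and l: "l \<in> S"
  shows "E k l = E l k"
proof -
  have EG: "(\<Sum>m\<in>S. E k m * G m l) = (if k = l then 1 else 0)" if "k \<in> S" "l \<in> S" for k l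
    using E that by (auto simp: left_inverse_on_def)
  have GE: "(\<Sum>m\<in>S. G i m * E l m) = (if i = l then 1 else 0)" if "i \<in> S" "l \<in> S" for i l
  proof -
    have "(\<Sum>m\<in>S. G i m * E l m) = (\<Sum>m\<in>S. E l m * G m i)"
      using that by (intro sum.cong refl) (simp add: sym mult.commute)
    then show ?thesis using EG that by auto
  qed
  have "E l k = (\<Sum>m\<in>S. (\<Sum>i\<in>S. E k i * G i m) * E l m)"
    using k fin by (simp add: EG sum_delta_mult cong: sum.cong)
  also have "\<dots> = (\<Sum>i\<in>S. E k i * (\<Sum>m\<in>S. G i m * E l m))"
    by (rule sum_mult_assoc)
  also have "\<dots> = E k l"
    using l fin by (simp add: GE sum_delta_mult cong: sum.cong)
  finally show ?thesis by simp
qed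

text \<open>
  This is the computation \<open>M E = E (G M) E = E (M\<^sup>T G) E = E M\<^sup>T\<close>.
\<close>

theorem self_adjoint_imp_inverse_intertwines:
  assumes fin: "finite S" and E: "left_inverse_on S E G"
    and sym: "\<And>k l. k \<in> S \<Longrightarrow> l \<in> S \<Longrightarrow> G k l = G l k"
    and adj: "\<And>k l. k \<in> S \<Longrightarrow> l \<in> S \<Longrightarrow> (\<Sum>m\<in>S. G k m * M m l) = (\<Sum>m\<in>S. G l m * M m k)"
    and k: "k \<in> S" and l: "l \<in> S"
  shows "(\<Sum>m\<in>S. M k m * E m l) = (\<Sum>m\<in>S. M l m * E k m)"
proof -
  have EG: "(\<Sum>m\<in>S. E k m * G m l) = (if k = l then 1 else 0)" if "k \<in> S" "l \<in> S" for k l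
    using E that by (auto simp: left_inverse_on_def)
  have GE: "(\<Sum>m\<in>S. G m i * E m l) = (if i = l then 1 else 0)" if "i \<in> S" "l \<in> S" for i l
  proof -
    have "(\<Sum>m\<in>S. G m i * E m l) = (\<Sum>m\<in>S. E l m * G m i)"
      using that by (intro sum.cong refl) (simp add: left_inverse_sym[OF fin E sym] mult.commute)
    then show ?thesis using EG that by auto
  qed
  define A where "A = (\<lambda>i j. \<Sum>m\<in>S. G i m * M m j)"
  have "(\<Sum>m\<in>S. M k m * E m l) = (\<Sum>i\<in>S. (\<Sum>p\<in>S. E k p * G p i) * (\<Sum>m\<in>S. M i m * E m l))"
    using k fin by (simp add: EG sum_delta_mult cong: sum.cong)
  also have "\<dots> = (\<Sum>p\<in>S. E k p * (\<Sum>m\<in>S. A p m * E m l))"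
    unfolding A_def by (simp only: sum_mult_assoc)
  also have "\<dots> = (\<Sum>p\<in>S. E k p * (\<Sum>m\<in>S. (\<Sum>i\<in>S. M i p * G m i) * E m l))"
  proof (intro sum.cong refl arg_cong[of _ _ "\<lambda>u. _ * u"] arg_cong[of _ _ "\<lambda>u. u * _"])
    fix p m assume "p \<in> S" "m \<in> S"
    then show "A p m = (\<Sum>i\<in>S. M i p * G m i)"
      using adj[of p m] by (simp add: A_def mult.commute)
  qed
  also have "\<dots> = (\<Sum>p\<in>S. E k p * (\<Sum>i\<in>S. M i p * (\<Sum>m\<in>S. G m i * E m l)))"
    using sum_mult_assoc[of _ "\<lambda>i m. G m i"] by simp
  also have "\<dots> = (\<Sum>p\<in>S. E k p * M l p)"
    using l fin by (simp add: GE sum_delta_mult cong: sum.cong)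
  finally show ?thesis by (simp add: mult.commute)
qed

section \<open>The Dirichlet integral over the triangle\<close>

lemma nn_integral_Beta:
  fixes a b :: real
  assumes "a > 0" "b > 0"
  shows "(\<integral>\<^sup>+t. ennreal (indicator {0..1} t * (t powr (a - 1) * (1 - t) powr (b - 1))) \<partial>lborel)
         = ennreal (Beta a b)"
  using nn_integral_has_integral_lebesgue[OF _ has_integral_Beta_real[OF assms]] by simp

lemma nn_integral_scaled_Beta:
  fixes a b s :: real
  assumes "a > 0" "b > 0" "s > 0"
  shows "(\<integral>\<^sup>+t. ennreal (indicator {0..s} t * (t powr (a - 1) * (s - t) powr (b - 1))) \<partial>lborel)
         = ennreal (s powr (a + b - 1) * Beta a b)"
proof -
  have "(\<integral>\<^sup>+t. ennreal (indicator {0..s} t * (t powr (a - 1) * (s - t) powr (b - 1))) \<partial>lborel)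
      = ennreal s * (\<integral>\<^sup>+t. ennreal (indicator {0..s} (s * t)
           * ((s * t) powr (a - 1) * (s - s * t) powr (b - 1))) \<partial>lborel)"
    using assms by (subst nn_integral_real_affine[where c = s and t = 0]) auto
  also have "(\<lambda>t. ennreal (indicator {0..s} (s * t)
           * ((s * t) powr (a - 1) * (s - s * t) powr (b - 1))))
      = (\<lambda>t. ennreal (s powr (a + b - 2))
           * ennreal (indicator {0..1} t * (t powr (a - 1) * (1 - t) powr (b - 1))))"
  proof (rule ext)
    fix t :: real
    have "indicator {0..s} (s * t) * ((s * t) powr (a - 1) * (s - s * t) powr (b - 1))
        = s powr (a + b - 2) * (indicator {0..1} t * (t powr (a - 1) * (1 - t) powr (b - 1)))"
    proof (cases "0 \<le> t \<and> t \<le> 1")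
      case True
      have "s * t \<le> s" using True assms mult_left_le[of t s] by simp
      moreover have "(s * t) powr (a - 1) = s powr (a - 1) * t powr (a - 1)"
        using True assms by (simp add: powr_mult)
      moreover have "(s - s * t) powr (b - 1) = s powr (b - 1) * (1 - t) powr (b - 1)"
        using True assms powr_mult[of s "1 - t" "b - 1"] by (simp add: algebra_simps)
      moreover have "s powr (a + b - 2) = s powr (a - 1) * s powr (b - 1)"
        by (simp add: powr_add[symmetric])
      ultimately show ?thesis using True assms by simp
    next
      case False
      have "\<not> (0 \<le> s * t \<and> s * t \<le> s)"
        using False assms by (simp add: zero_le_mult_iff)
      then show ?thesis using False by (auto simp: indicator_def)
    qed
    then show "ennreal (indicator {0..s} (s * t)
           * ((s * t) powr (a - 1) * (s - s * t) powr (b - 1)))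
      = ennreal (s powr (a + b - 2))
           * ennreal (indicator {0..1} t * (t powr (a - 1) * (1 - t) powr (b - 1)))"
      by (simp add: ennreal_mult'[symmetric])
  qed
  also have "ennreal s * (\<integral>\<^sup>+t. ennreal (s powr (a + b - 2))
           * ennreal (indicator {0..1} t * (t powr (a - 1) * (1 - t) powr (b - 1))) \<partial>lborel)
      = ennreal s * (ennreal (s powr (a + b - 2)) * ennreal (Beta a b))"
    by (subst nn_integral_cmult) (simp_all add: nn_integral_Beta assms)
  also have "\<dots> = ennreal (s powr (a + b - 1) * Beta a b)"
  proof -
    have "s * s powr (a + b - 2) = s powr (a + b - 1)"
      using assms powr_add[of s 1 "a + b - 2"] by (simp add: algebra_simps)
    moreover have "Beta a b \<ge> 0"
      using assms by (simp add: Beta_def Gamma_real_nonneg)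
    ultimately show ?thesis
      using assms by (simp add: ennreal_mult'[symmetric] mult.assoc[symmetric])
  qed
  finally show ?thesis .
qed

lemma triangle_borel [measurable]: "triangle \<in> sets borel"
proof -
  have "triangle = {x. 0 \<le> fst x} \<inter> {x. 0 \<le> snd x} \<inter> {x. fst x + snd x \<le> 1}"
    by (auto simp: triangle_def)
  moreover have "closed \<dots>"
    by (intro closed_Int closed_Collect_le continuous_intros)
  ultimately show ?thesis by simp
qed

text \<open>
  Integrating over the second coordinate first gives a scaled Beta integral, which leaves a power
  of \<open>1 - x\<close> and thus a second Beta integral. The factors \<open>Gamma (b + c)\<close> of the two cancel.
  Nonnegative integrals are used throughout so that integrability comes with the value.
\<close>

theorem dirichlet_integral:
  fixes a b c :: real
  assumes "a > 0" "b > 0" "c > 0"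
  shows "has_bochner_integral lborel
    (\<lambda>x. indicator triangle x
       * (fst x powr (a - 1) * snd x powr (b - 1) * (1 - (fst x + snd x)) powr (c - 1)))
    (Gamma a * Gamma b * Gamma c / Gamma (a + b + c))"
proof -
  define f where "f = (\<lambda>x :: real \<times> real. indicator triangle x
       * (fst x powr (a - 1) * snd x powr (b - 1) * (1 - (fst x + snd x)) powr (c - 1)) :: real)"
  have f_meas: "f \<in> borel_measurable borel"
    unfolding f_def
    by (intro borel_measurable_times borel_measurable_indicator powr_real_measurable triangle_borel
        borel_measurable_continuous_onI continuous_intros)
  have "(\<integral>\<^sup>+x. ennreal (f x) \<partial>lborel) = (\<integral>\<^sup>+x. \<integral>\<^sup>+y. ennreal (f (x, y)) \<partial>lborel \<partial>lborel)"
    using f_meas lborel.nn_integral_fst[of "\<lambda>x. ennreal (f x)" lborel]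
    by (simp add: lborel_prod)
  also have "\<dots> = (\<integral>\<^sup>+x. ennreal (Beta b c)
      * ennreal (indicator {0..1} x * (x powr (a - 1) * (1 - x) powr (b + c - 1))) \<partial>lborel)"
  proof (rule nn_integral_cong)
    fix x :: real
    show "(\<integral>\<^sup>+y. ennreal (f (x, y)) \<partial>lborel) = ennreal (Beta b c)
      * ennreal (indicator {0..1} x * (x powr (a - 1) * (1 - x) powr (b + c - 1)))"
    proof (cases "0 \<le> x \<and> x < 1")
      case True
      have "f (x, y) = x powr (a - 1)
          * (indicator {0..1-x} y * (y powr (b - 1) * ((1 - x) - y) powr (c - 1)))" for y
        using True by (auto simp: f_def indicator_def triangle_def algebra_simps)
      then have "(\<integral>\<^sup>+y. ennreal (f (x, y)) \<partial>lborel) = (\<integral>\<^sup>+y. ennreal (x powr (a - 1))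
          * ennreal (indicator {0..1-x} y * (y powr (b - 1) * ((1 - x) - y) powr (c - 1))) \<partial>lborel)"
        by (simp add: ennreal_mult'[symmetric])
      also have "\<dots> = ennreal (x powr (a - 1)) * ennreal ((1 - x) powr (b + c - 1) * Beta b c)"
        using True assms nn_integral_scaled_Beta[of b c "1 - x"]
        by (subst nn_integral_cmult) simp_all
      finally show ?thesis using True assms
        by (simp add: ennreal_mult'[symmetric] ennreal_mult''[symmetric] Beta_def mult_ac)
    next
      case False
      \<comment> \<open>At \<open>x = 1\<close> both sides are zero because \<open>0 powr _ = 0\<close>, even for negative exponents.\<close>
      have "f (x, y) = 0" for y
        using False by (auto simp: f_def indicator_def triangle_def)
      moreover have "indicator {0..1} x * (x powr (a - 1) * (1 - x) powr (b + c - 1)) = (0 :: real)"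
        using False by (auto simp: indicator_def)
      ultimately show ?thesis by simp
    qed
  qed
  also have "\<dots> = ennreal (Beta b c) * ennreal (Beta a (b + c))"
    using assms nn_integral_Beta[of a "b + c"] by (subst nn_integral_cmult) simp_all
  also have "\<dots> = ennreal (Gamma a * Gamma b * Gamma c / Gamma (a + b + c))"
  proof -
    have "Gamma (b + c) \<noteq> 0" using assms Gamma_real_pos[of "b + c"] by linarith
    then show ?thesis
      using assms by (simp add: Beta_def ennreal_mult'[symmetric] add.assoc)
  qed
  finally show ?thesis
    unfolding f_def[symmetric]
    using assms f_meas
    by (intro has_bochner_integral_nn_integral) (auto simp: f_def)
qed

section \<open>Bernstein polynomials as a basis of the bivariate polynomials\<close>

lemma finite_Theta: "finite (Theta n)"
proof (rule finite_subset)
  show "Theta n \<subseteq> {0..int n} \<times> {0..int n}"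
    by (auto simp: Theta_def)
qed simp

lemma Theta_nat_iff: "(int i, int j) \<in> Theta n \<longleftrightarrow> i + j \<le> n"
  by (auto simp: Theta_def)

lemma Theta_cases:
  assumes "k \<in> Theta n"
  obtains i j m where "k = (int i, int j)" "n = i + j + m"
proof -
  obtain a b where k: "k = (a, b)" by (cases k)
  show ?thesis
    using assms that[of "nat a" "nat b" "nat (int n - a - b)"]
    by (auto simp: k Theta_def)
qed

text \<open>
  The parametrisation by all three barycentric exponents avoids truncated differences: an index of
  \<open>Theta n\<close> is written as \<open>(i, j)\<close> with \<open>n = i + j + m\<close>.
\<close>

definition multinom :: "nat \<Rightarrow> nat \<Rightarrow> nat \<Rightarrow> real" where
  "multinom i j m = fact (i + j + m) / (fact i * fact j * fact m)"

lemma multinom_pos: "multinom i j m > 0"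
  by (simp add: multinom_def)

lemma bernstein_nat:
  "bernstein (i + j + m) (int i, int j) x
     = multinom i j m * fst x ^ i * snd x ^ j * (1 - (fst x + snd x)) ^ m"
  by (cases x) (simp add: multinom_def)

lemma multinom_Suc:
  "multinom (Suc i) j m * real (Suc i) = real (Suc (i + j + m)) * multinom i j m"
  "multinom i (Suc j) m * real (Suc j) = real (Suc (i + j + m)) * multinom i j m"
  "multinom i j (Suc m) * real (Suc m) = real (Suc (i + j + m)) * multinom i j m"
  by (simp_all add: multinom_def divide_simps del: of_nat_Suc)

definition fspan :: "'i set \<Rightarrow> ('i \<Rightarrow> 'x \<Rightarrow> real) \<Rightarrow> ('x \<Rightarrow> real) set" where
  "fspan I b = {p. \<exists>c. p = (\<lambda>x. \<Sum>i\<in>I. c i * b i x)}"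

lemma fspanI: "p = (\<lambda>x. \<Sum>i\<in>I. c i * b i x) \<Longrightarrow> p \<in> fspan I b"
  unfolding fspan_def by blast

lemma fspan_add:
  assumes "p \<in> fspan I b" "q \<in> fspan I b"
  shows "(\<lambda>x. p x + q x) \<in> fspan I b"
proof -
  obtain c d where "p = (\<lambda>x. \<Sum>i\<in>I. c i * b i x)" "q = (\<lambda>x. \<Sum>i\<in>I. d i * b i x)"
    using assms by (auto simp: fspan_def)
  then have "(\<lambda>x. p x + q x) = (\<lambda>x. \<Sum>i\<in>I. (c i + d i) * b i x)"
    by (simp add: sum.distrib distrib_right)
  then show ?thesis by (rule fspanI)
qed

lemma fspan_scale:
  assumes "p \<in> fspan I b"
  shows "(\<lambda>x. r * p x) \<in> fspan I b"
proof -
  obtain c where "p = (\<lambda>x. \<Sum>i\<in>I. c i * b i x)"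
    using assms by (auto simp: fspan_def)
  then have "(\<lambda>x. r * p x) = (\<lambda>x. \<Sum>i\<in>I. (r * c i) * b i x)"
    by (simp add: sum_distrib_left mult.assoc)
  then show ?thesis by (rule fspanI)
qed

lemma fspan_base:
  assumes "finite I" "i \<in> I"
  shows "b i \<in> fspan I b"
proof -
  have "b i = (\<lambda>x. \<Sum>j\<in>I. (if j = i then 1 else 0) * b j x)"
    using assms by (simp add: if_distrib[of "\<lambda>t. t * _"] cong: if_cong)
  then show ?thesis by (rule fspanI)
qed

lemma fspan_sum:
  assumes "\<And>j. j \<in> J \<Longrightarrow> p j \<in> fspan I b"
  shows "(\<lambda>x. \<Sum>j\<in>J. p j x) \<in> fspan I b"
proof -
  have "(\<lambda>x. 0) \<in> fspan I b"
    by (rule fspanI[where c = "\<lambda>_. 0"]) simp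
  then show ?thesis
    using assms by (induction J rule: infinite_finite_induct) (simp_all add: fspan_add)
qed

lemma fspan_mult:
  assumes "\<And>i. i \<in> I \<Longrightarrow> (\<lambda>x. g x * b i x) \<in> fspan J d" "p \<in> fspan I b"
  shows "(\<lambda>x. g x * p x) \<in> fspan J d"
proof -
  obtain c where "p = (\<lambda>x. \<Sum>i\<in>I. c i * b i x)"
    using assms by (auto simp: fspan_def)
  then have "(\<lambda>x. g x * p x) = (\<lambda>x. \<Sum>i\<in>I. c i * (g x * b i x))"
    by (simp add: sum_distrib_left mult_ac)
  moreover have "(\<lambda>x. \<Sum>i\<in>I. c i * (g x * b i x)) \<in> fspan J d"
    by (intro fspan_sum fspan_scale assms)
  ultimately show ?thesis by simp
qed

lemma fspan_subset:
  assumes "\<And>i. i \<in> I \<Longrightarrow> b i \<in> fspan J d"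
  shows "fspan I b \<subseteq> fspan J d"
  using fspan_mult[of I "\<lambda>_. 1" b J d] assms by auto

text \<open>
  Any family with these closure properties contains the products of powers of barycentric coordinates
  in the expected degree. The span of the monomials and the span of the Bernstein polynomials both
  have them, and each is generated by such products, so the two contain each other.
\<close>

locale degree_filtration =
  fixes F :: "nat \<Rightarrow> (real \<times> real \<Rightarrow> real) set"
  assumes one: "(\<lambda>x. 1) \<in> F 0"
    and add: "p \<in> F n \<Longrightarrow> q \<in> F n \<Longrightarrow> (\<lambda>x. p x + q x) \<in> F n"
    and scale: "p \<in> F n \<Longrightarrow> (\<lambda>x. r * p x) \<in> F n"
    and mult_fst: "p \<in> F n \<Longrightarrow> (\<lambda>x. fst x * p x) \<in> F (Suc n)"
    and mult_snd: "p \<in> F n \<Longrightarrow> (\<lambda>x. snd x * p x) \<in> F (Suc n)"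
    and up: "p \<in> F n \<Longrightarrow> p \<in> F (Suc n)"
begin

lemma mono: "m \<le> n \<Longrightarrow> F m \<subseteq> F n"
  by (rule lift_Suc_mono_le) (use up in auto)

lemma barycentric_monomial:
  "(\<lambda>x. fst x ^ i * snd x ^ j * (1 - (fst x + snd x)) ^ m) \<in> F (i + j + m)"
proof (induction m)
  case 0
  have "(\<lambda>x. fst x ^ i * snd x ^ j) \<in> F (i + j)"
  proof (induction j)
    case 0
    have "(\<lambda>x. fst x ^ i) \<in> F i"
      by (induction i) (use one mult_fst in auto)
    then show ?case by simp
  next
    case (Suc j)
    from mult_snd[OF this] show ?case by (simp add: mult_ac)
  qed
  then show ?case by simp
next
  case (Suc m)
  let ?p = "\<lambda>x :: real \<times> real. fst x ^ i * snd x ^ j * (1 - (fst x + snd x)) ^ m"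
  have "(\<lambda>x. ?p x + - 1 * (fst x * ?p x + snd x * ?p x)) \<in> F (Suc (i + j + m))"
    by (intro add scale up mult_fst mult_snd Suc)
  also have "(\<lambda>x. ?p x + - 1 * (fst x * ?p x + snd x * ?p x))
      = (\<lambda>x. fst x ^ i * snd x ^ j * (1 - (fst x + snd x)) ^ Suc m)"
    by (rule ext) (simp add: algebra_simps)
  finally show ?case by simp
qed

end

definition monomial2 :: "int \<times> int \<Rightarrow> real \<times> real \<Rightarrow> real" where
  "monomial2 k x = fst x ^ nat (fst k) * snd x ^ nat (snd k)"

lemma Pi2_eq_fspan: "Pi2 n = fspan (Theta n) monomial2"
  unfolding Pi2_def fspan_def
  by (simp add: case_prod_unfold monomial2_def mult.assoc)

lemma degree_filtration_Pi2: "degree_filtration Pi2"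
proof
  fix p n
  assume p: "p \<in> Pi2 n"
  show "(\<lambda>x. fst x * p x) \<in> Pi2 (Suc n)"
    unfolding Pi2_eq_fspan
  proof (rule fspan_mult[OF _ p[unfolded Pi2_eq_fspan]])
    fix k assume "k \<in> Theta n"
    then obtain i j m where k: "k = (int i, int j)" "n = i + j + m" by (rule Theta_cases)
    have "monomial2 (int (Suc i), int j) \<in> fspan (Theta (Suc n)) monomial2"
      by (intro fspan_base finite_Theta) (simp add: Theta_nat_iff k del: of_nat_Suc)
    also have "monomial2 (int (Suc i), int j) = (\<lambda>x. fst x * monomial2 k x)"
      by (rule ext) (simp add: monomial2_def k del: of_nat_Suc)
    finally show "(\<lambda>x. fst x * monomial2 k x) \<in> fspan (Theta (Suc n)) monomial2" .
  qed
  show "(\<lambda>x. snd x * p x) \<in> Pi2 (Suc n)"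
    unfolding Pi2_eq_fspan
  proof (rule fspan_mult[OF _ p[unfolded Pi2_eq_fspan]])
    fix k assume "k \<in> Theta n"
    then obtain i j m where k: "k = (int i, int j)" "n = i + j + m" by (rule Theta_cases)
    have "monomial2 (int i, int (Suc j)) \<in> fspan (Theta (Suc n)) monomial2"
      by (intro fspan_base finite_Theta) (simp add: Theta_nat_iff k del: of_nat_Suc)
    also have "monomial2 (int i, int (Suc j)) = (\<lambda>x. snd x * monomial2 k x)"
      by (rule ext) (simp add: monomial2_def k del: of_nat_Suc)
    finally show "(\<lambda>x. snd x * monomial2 k x) \<in> fspan (Theta (Suc n)) monomial2" .
  qed
  have "fspan (Theta n) monomial2 \<subseteq> fspan (Theta (Suc n)) monomial2"
    by (intro fspan_subset fspan_base finite_Theta) (auto simp: Theta_def)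
  then show "p \<in> Pi2 (Suc n)"
    using p unfolding Pi2_eq_fspan by blast
next
  have "monomial2 (0, 0) \<in> fspan (Theta 0) monomial2"
    by (intro fspan_base finite_Theta) (simp add: Theta_def)
  then show "(\<lambda>x. 1) \<in> Pi2 0"
    by (simp add: Pi2_eq_fspan monomial2_def[abs_def])
qed (simp_all add: Pi2_eq_fspan fspan_add fspan_scale)

text \<open>
  Multiplying a Bernstein polynomial by a barycentric coordinate gives a multiple of one of the next
  degree. Since the three coordinates add up to \<open>1\<close>, adding the three products yields the degree
  elevation that closure under increasing \<open>n\<close> demands.
\<close>

lemma degree_filtration_bernstein: "degree_filtration (\<lambda>n. fspan (Theta n) (bernstein n))"
proof
  fix p n
  let ?V = "fspan (Theta (Suc n)) (bernstein (Suc n))"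
  assume p: "p \<in> fspan (Theta n) (bernstein n)"
  have coords: "(\<lambda>x. fst x * bernstein n k x) \<in> ?V"
    "(\<lambda>x. snd x * bernstein n k x) \<in> ?V"
    "(\<lambda>x. (1 - (fst x + snd x)) * bernstein n k x) \<in> ?V" if "k \<in> Theta n" for k
  proof -
    obtain i j m where k: "k = (int i, int j)" and n: "n = i + j + m"
      using \<open>k \<in> Theta n\<close> by (rule Theta_cases)
    have B: "bernstein (Suc n) (int i', int j') \<in> ?V" if "i' + j' \<le> Suc n" for i' j'
      using that by (intro fspan_base finite_Theta) (simp add: Theta_nat_iff)
    have "(\<lambda>x. real (Suc i) / real (Suc n) * bernstein (Suc n) (int (Suc i), int j) x) \<in> ?V"
      by (intro fspan_scale B) (simp add: n)
    also have "(\<lambda>x. real (Suc i) / real (Suc n) * bernstein (Suc n) (int (Suc i), int j) x)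
        = (\<lambda>x. fst x * bernstein n k x)"
    proof
      fix x :: "real \<times> real"
      show "real (Suc i) / real (Suc n) * bernstein (Suc n) (int (Suc i), int j) x
          = fst x * bernstein n k x"
        using bernstein_nat[of "Suc i" j m x] bernstein_nat[of i j m x] multinom_Suc(1)[of i j m]
        by (simp add: k n field_simps del: of_nat_Suc bernstein.simps)
    qed
    finally show "(\<lambda>x. fst x * bernstein n k x) \<in> ?V" .
    have "(\<lambda>x. real (Suc j) / real (Suc n) * bernstein (Suc n) (int i, int (Suc j)) x) \<in> ?V"
      by (intro fspan_scale B) (simp add: n)
    also have "(\<lambda>x. real (Suc j) / real (Suc n) * bernstein (Suc n) (int i, int (Suc j)) x)
        = (\<lambda>x. snd x * bernstein n k x)"
    proof
      fix x :: "real \<times> real"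
      show "real (Suc j) / real (Suc n) * bernstein (Suc n) (int i, int (Suc j)) x
          = snd x * bernstein n k x"
        using bernstein_nat[of i "Suc j" m x] bernstein_nat[of i j m x] multinom_Suc(2)[of i j m]
        by (simp add: k n field_simps del: of_nat_Suc bernstein.simps)
    qed
    finally show "(\<lambda>x. snd x * bernstein n k x) \<in> ?V" .
    have "(\<lambda>x. real (Suc m) / real (Suc n) * bernstein (Suc n) (int i, int j) x) \<in> ?V"
      by (intro fspan_scale B) (simp add: n)
    also have "(\<lambda>x. real (Suc m) / real (Suc n) * bernstein (Suc n) (int i, int j) x)
        = (\<lambda>x. (1 - (fst x + snd x)) * bernstein n k x)"
    proof
      fix x :: "real \<times> real"
      define z where "z = 1 - (fst x + snd x)"
      show "real (Suc m) / real (Suc n) * bernstein (Suc n) (int i, int j) x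
          = (1 - (fst x + snd x)) * bernstein n k x"
        using bernstein_nat[of i j "Suc m" x] bernstein_nat[of i j m x] multinom_Suc(3)[of i j m]
        unfolding z_def[symmetric]
        by (simp add: k n field_simps del: of_nat_Suc bernstein.simps)
    qed
    finally show "(\<lambda>x. (1 - (fst x + snd x)) * bernstein n k x) \<in> ?V" .
  qed
  show mf: "(\<lambda>x. fst x * p x) \<in> ?V"
    using coords(1) p by (rule fspan_mult)
  show ms: "(\<lambda>x. snd x * p x) \<in> ?V"
    using coords(2) p by (rule fspan_mult)
  have "(\<lambda>x. (1 - (fst x + snd x)) * p x) \<in> ?V"
    using coords(3) p by (rule fspan_mult)
  from fspan_add[OF fspan_add[OF mf ms] this] show "p \<in> ?V"
    by (simp add: algebra_simps)
next
  have "bernstein 0 (0, 0) \<in> fspan (Theta 0) (bernstein 0)"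
    by (intro fspan_base finite_Theta) (simp add: Theta_def)
  moreover have "bernstein 0 (0, 0) = (\<lambda>x. 1)"
    by (simp add: fun_eq_iff)
  ultimately show "(\<lambda>x. 1) \<in> fspan (Theta 0) (bernstein 0)" by simp
qed (simp_all add: fspan_add fspan_scale)

theorem Pi2_eq_bernstein_span: "Pi2 n = fspan (Theta n) (bernstein n)"
proof
  interpret P: degree_filtration Pi2 by (rule degree_filtration_Pi2)
  interpret B: degree_filtration "\<lambda>n. fspan (Theta n) (bernstein n)"
    by (rule degree_filtration_bernstein)
  show "Pi2 n \<subseteq> fspan (Theta n) (bernstein n)"
    unfolding Pi2_eq_fspan
  proof (rule fspan_subset)
    fix k assume "k \<in> Theta n"
    then obtain i j m where k: "k = (int i, int j)" "n = i + j + m" by (rule Theta_cases)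
    have "monomial2 k \<in> fspan (Theta (i + j)) (bernstein (i + j))"
      using B.barycentric_monomial[of i j 0] by (simp add: k monomial2_def[abs_def])
    then show "monomial2 k \<in> fspan (Theta n) (bernstein n)"
      using B.mono[of "i + j" n] k by auto
  qed
  have "bernstein n k \<in> fspan (Theta n) monomial2" if kin: "k \<in> Theta n" for k
  proof -
    obtain i j m where k: "k = (int i, int j)" "n = i + j + m"
      using kin by (rule Theta_cases)
    have "bernstein n k
        = (\<lambda>x. multinom i j m * (fst x ^ i * snd x ^ j * (1 - (fst x + snd x)) ^ m))"
      by (rule ext) (simp add: k bernstein_nat mult.assoc del: bernstein.simps)
    then show ?thesis
      using P.scale[OF P.barycentric_monomial[of i j m]] by (simp add: k Pi2_eq_fspan)
  qed
  then show "fspan (Theta n) (bernstein n) \<subseteq> Pi2 n"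
    unfolding Pi2_eq_fspan by (intro fspan_subset)
qed

lemma polynomial_coeffs_zero:
  fixes c :: "nat \<Rightarrow> real"
  assumes "\<And>x. x > 0 \<Longrightarrow> (\<Sum>i\<le>n. c i * x ^ i) = 0" "i \<le> n"
  shows "c i = 0"
proof (rule ccontr)
  assume "c i \<noteq> 0"
  then have "finite {x. (\<Sum>i\<le>n. c i * x ^ i) = 0}"
    using assms(2) by (auto simp: polyfun_finite_roots)
  moreover have "{0<..} \<subseteq> {x. (\<Sum>i\<le>n. c i * x ^ i) = 0}"
    using assms(1) by auto
  ultimately have "finite {0 :: real<..}" by (rule rev_finite_subset)
  then show False using infinite_Ioi by blast
qed

lemma bivariate_polynomial_coeffs_zero:
  fixes d :: "nat \<Rightarrow> nat \<Rightarrow> real"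
  assumes "\<And>x y. x > 0 \<Longrightarrow> y > 0 \<Longrightarrow> (\<Sum>i\<le>n. \<Sum>j\<le>n. d i j * (x ^ i * y ^ j)) = 0"
    and "i \<le> n" "j \<le> n"
  shows "d i j = 0"
proof (rule polynomial_coeffs_zero[OF _ \<open>j \<le> n\<close>])
  fix y :: real assume "y > 0"
  show "(\<Sum>j\<le>n. d i j * y ^ j) = 0"
  proof (rule polynomial_coeffs_zero[OF _ \<open>i \<le> n\<close>])
    fix x :: real assume "x > 0"
    show "(\<Sum>i\<le>n. (\<Sum>j\<le>n. d i j * y ^ j) * x ^ i) = 0"
      using assms(1)[OF \<open>x > 0\<close> \<open>y > 0\<close>] by (simp add: sum_distrib_left sum_distrib_right mult_ac)
  qed
qed

lemma sum_Theta:
  "(\<Sum>k\<in>Theta n. f k) = (\<Sum>i\<le>n. \<Sum>j\<le>n. if i + j \<le> n then f (int i, int j) else (0::real))"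
proof -
  have "(\<Sum>k\<in>Theta n. f k)
      = (\<Sum>p\<in>{p \<in> {..n} \<times> {..n}. fst p + snd p \<le> n}. f (int (fst p), int (snd p)))"
    by (rule sum.reindex_bij_witness[where
          i = "\<lambda>p. (int (fst p), int (snd p))" and j = "\<lambda>k. (nat (fst k), nat (snd k))"])
       (auto simp: Theta_def)
  also have "\<dots> = (\<Sum>p\<in>{..n} \<times> {..n}. if fst p + snd p \<le> n then f (int (fst p), int (snd p)) else 0)"
    by (rule sum.inter_filter) simp
  finally show ?thesis
    by (simp add: sum.cartesian_product case_prod_unfold)
qed

text \<open>
  In the projective coordinates \<open>x = x\<^sub>1 / x\<^sub>3\<close>, \<open>y = x\<^sub>2 / x\<^sub>3\<close> with \<open>x\<^sub>3 = 1 - x\<^sub>1 - x\<^sub>2\<close>, a Bernstein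
  polynomial divided by \<open>x\<^sub>3 ^ n\<close> is a multiple of a monomial. The value at the barycentre, where \<open>x = y = 1\<close>,
  serves to express its coefficient.
\<close>

lemma bernstein_projective:
  assumes "k \<in> Theta n" "x > 0" "y > 0"
  shows "bernstein n k (x / (1 + x + y), y / (1 + x + y)) * (1 + x + y) ^ n
    = bernstein n k (1/3, 1/3) * 3 ^ n * (x ^ nat (fst k) * y ^ nat (snd k))"
proof -
  obtain i j m where k: "k = (int i, int j)" and n: "n = i + j + m"
    using assms(1) by (rule Theta_cases)
  define s where "s = 1 + x + y"
  have s: "s > 0" using assms by (simp add: s_def)
  have "1 - (x / s + y / s) = 1 / s"
    using s by (simp add: field_simps) (simp add: s_def)
  then show ?thesis
    using s by (simp add: k n bernstein_nat power_add power_divide del: bernstein.simps flip: s_def)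
qed

text \<open>
  The projective coordinates range over all pairs of positive reals when the point ranges over the
  interior of the triangle, so independence reduces to that of the monomials. That the relation is
  only assumed in the interior is what the definiteness of the inner product will call for.
\<close>

lemma bernstein_independent:
  assumes zero: "\<And>x. 0 < fst x \<Longrightarrow> 0 < snd x \<Longrightarrow> fst x + snd x < 1
      \<Longrightarrow> (\<Sum>k\<in>Theta n. c k * bernstein n k x) = 0"
    and "k \<in> Theta n"
  shows "c k = 0"
proof -
  define e where "e = (\<lambda>k. c k * bernstein n k (1/3, 1/3) * 3 ^ n)"
  define d where "d = (\<lambda>i j. if i + j \<le> n then e (int i, int j) else 0)"
  have "(\<Sum>i\<le>n. \<Sum>j\<le>n. d i j * (x ^ i * y ^ j)) = 0" if "x > 0" "y > 0" for x y :: real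
  proof -
    let ?s = "1 + x + y"
    have "(\<Sum>i\<le>n. \<Sum>j\<le>n. d i j * (x ^ i * y ^ j))
        = (\<Sum>k\<in>Theta n. e k * (x ^ nat (fst k) * y ^ nat (snd k)))"
      unfolding sum_Theta d_def by (intro sum.cong refl) simp
    also have "\<dots> = (\<Sum>k\<in>Theta n. c k * bernstein n k (x / ?s, y / ?s) * ?s ^ n)"
      using bernstein_projective[OF _ that, of _ n]
      by (intro sum.cong refl) (simp add: e_def mult.assoc del: bernstein.simps)
    also have "\<dots> = (\<Sum>k\<in>Theta n. c k * bernstein n k (x / ?s, y / ?s)) * ?s ^ n"
      by (simp add: sum_distrib_right del: bernstein.simps)
    also have "(\<Sum>k\<in>Theta n. c k * bernstein n k (x / ?s, y / ?s)) = 0"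
    proof (rule zero)
      show "fst (x / ?s, y / ?s) + snd (x / ?s, y / ?s) < 1"
        using that by (simp flip: add_divide_distrib)
    qed (use that in auto)
    finally show ?thesis by simp
  qed
  then have d0: "d i j = 0" if "i \<le> n" "j \<le> n" for i j
    using that by (rule bivariate_polynomial_coeffs_zero)
  obtain i j m where k: "k = (int i, int j)" and n: "n = i + j + m"
    using assms(2) by (rule Theta_cases)
  have "e k = 0" using d0[of i j] by (simp add: d_def k n)
  moreover have "bernstein n k (1/3, 1/3) \<noteq> 0"
    using multinom_pos[of i j m] by (simp add: k n bernstein_nat del: bernstein.simps)
  ultimately show ?thesis by (simp add: e_def del: bernstein.simps)
qed

section \<open>The Gram matrix and its inverse\<close>

definition gram :: "nat \<Rightarrow> real \<times> real \<times> real \<Rightarrow> int \<times> int \<Rightarrow> int \<times> int \<Rightarrow> real" where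
  "gram n \<alpha> k l = inner_prod \<alpha> (bernstein n k) (bernstein n l)"

text \<open>
  The convention \<open>0 powr _ = 0\<close> makes this true at \<open>x = 0\<close> as well, so that the boundary of the
  triangle needs no separate treatment.
\<close>

lemma powr_mult_power: "0 \<le> x \<Longrightarrow> x powr a * x ^ m = x powr (a + real m)"
  for x :: real
  by (cases "x = 0") (auto simp: powr_add powr_realpow)

abbreviation weight_const :: "real \<Rightarrow> real \<Rightarrow> real \<Rightarrow> real" where
  "weight_const \<alpha>1 \<alpha>2 \<alpha>3 \<equiv>
     Gamma (\<alpha>1 + \<alpha>2 + \<alpha>3 + 3) / (Gamma (\<alpha>1 + 1) * Gamma (\<alpha>2 + 1) * Gamma (\<alpha>3 + 1))"

text \<open>
  The weight and the two Bernstein polynomials merge into one Dirichlet integrand; the exponents of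
  the barycentric coordinates simply add up.
\<close>

lemma has_integral_bernstein_product:
  assumes "\<alpha>1 > -1" "\<alpha>2 > -1" "\<alpha>3 > -1" and n: "n = i + j + m" "n = i' + j' + m'"
  shows "has_bochner_integral lborel
     (\<lambda>x. indicator triangle x *\<^sub>R (weight (\<alpha>1, \<alpha>2, \<alpha>3) x
        * bernstein n (int i', int j') x * bernstein n (int i, int j) x))
     (weight_const \<alpha>1 \<alpha>2 \<alpha>3 * multinom i' j' m' * multinom i j m
        * (Gamma (\<alpha>1 + real (i + i') + 1) * Gamma (\<alpha>2 + real (j + j') + 1)
           * Gamma (\<alpha>3 + real (m + m') + 1) / Gamma (\<alpha>1 + \<alpha>2 + \<alpha>3 + real (2 * n) + 3)))"
proof -
  let ?a = "\<alpha>1 + real (i + i') + 1" and ?b = "\<alpha>2 + real (j + j') + 1"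
    and ?c = "\<alpha>3 + real (m + m') + 1"
  let ?C = "weight_const \<alpha>1 \<alpha>2 \<alpha>3 * multinom i' j' m' * multinom i j m"
  have abc: "?a + ?b + ?c = \<alpha>1 + \<alpha>2 + \<alpha>3 + real (2 * n) + 3"
    using arg_cong[OF n(1), of real] arg_cong[OF n(2), of real] by simp
  have "has_bochner_integral lborel
    (\<lambda>x. indicator triangle x
       * (fst x powr (?a - 1) * snd x powr (?b - 1) * (1 - (fst x + snd x)) powr (?c - 1)))
    (Gamma ?a * Gamma ?b * Gamma ?c / Gamma (?a + ?b + ?c))"
    using assms(1-3) by (intro dirichlet_integral) linarith+
  note this[unfolded abc]
  from has_bochner_integral_mult_right[OF this, of ?C]
  have "has_bochner_integral lborel
    (\<lambda>x. ?C * (indicator triangle x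
       * (fst x powr (?a - 1) * snd x powr (?b - 1) * (1 - (fst x + snd x)) powr (?c - 1))))
    (?C * (Gamma ?a * Gamma ?b * Gamma ?c / Gamma (\<alpha>1 + \<alpha>2 + \<alpha>3 + real (2 * n) + 3)))"
    by simp
  also have "(\<lambda>x. ?C * (indicator triangle x
       * (fst x powr (?a - 1) * snd x powr (?b - 1) * (1 - (fst x + snd x)) powr (?c - 1))))
    = (\<lambda>x. indicator triangle x *\<^sub>R (weight (\<alpha>1, \<alpha>2, \<alpha>3) x
        * bernstein n (int i', int j') x * bernstein n (int i, int j) x))"
  proof
    fix x :: "real \<times> real"
    show "?C * (indicator triangle x
       * (fst x powr (?a - 1) * snd x powr (?b - 1) * (1 - (fst x + snd x)) powr (?c - 1)))
      = indicator triangle x *\<^sub>R (weight (\<alpha>1, \<alpha>2, \<alpha>3) x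
        * bernstein n (int i', int j') x * bernstein n (int i, int j) x)"
    proof (cases "x \<in> triangle")
      case True
      define u v w where uvw: "u = fst x" "v = snd x" "w = 1 - (fst x + snd x)"
      have pos: "0 \<le> u" "0 \<le> v" "0 \<le> w"
        using True by (auto simp: triangle_def uvw)
      have W: "weight (\<alpha>1, \<alpha>2, \<alpha>3) x
          = weight_const \<alpha>1 \<alpha>2 \<alpha>3 * (u powr \<alpha>1 * v powr \<alpha>2 * w powr \<alpha>3)"
        by (cases x) (simp add: uvw)
      have B: "bernstein n (int i, int j) x = multinom i j m * (u ^ i * v ^ j * w ^ m)"
        using bernstein_nat[of i j m x] by (simp add: n(1) uvw del: bernstein.simps)
      have B': "bernstein n (int i', int j') x = multinom i' j' m' * (u ^ i' * v ^ j' * w ^ m')"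
        using bernstein_nat[of i' j' m' x] by (simp add: n(2) uvw del: bernstein.simps)
      have P: "u powr (?a - 1) = u powr \<alpha>1 * u ^ i * u ^ i'"
        "v powr (?b - 1) = v powr \<alpha>2 * v ^ j * v ^ j'"
        "w powr (?c - 1) = w powr \<alpha>3 * w ^ m * w ^ m'"
        using pos by (simp_all add: powr_mult_power add_ac)
      show ?thesis
        unfolding W B B' uvw(3)[symmetric] unfolding uvw(1)[symmetric] uvw(2)[symmetric] P
        using True by (simp add: mult_ac)
    qed simp
  qed
  finally show ?thesis .
qed

lemma gram_nat:
  assumes "\<alpha>1 > -1" "\<alpha>2 > -1" "\<alpha>3 > -1" and n: "n = i + j + m" "n = i' + j' + m'"
  shows "gram n (\<alpha>1, \<alpha>2, \<alpha>3) (int i', int j') (int i, int j) =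
     weight_const \<alpha>1 \<alpha>2 \<alpha>3 * multinom i' j' m' * multinom i j m
        * (Gamma (\<alpha>1 + real (i + i') + 1) * Gamma (\<alpha>2 + real (j + j') + 1)
           * Gamma (\<alpha>3 + real (m + m') + 1) / Gamma (\<alpha>1 + \<alpha>2 + \<alpha>3 + real (2 * n) + 3))"
  unfolding gram_def inner_prod_def set_lebesgue_integral_def
  by (rule has_bochner_integral_integral_eq[OF has_integral_bernstein_product[OF assms]])

lemma gram_sym: "gram n \<alpha> k l = gram n \<alpha> l k"
  by (simp add: gram_def inner_prod_def mult_ac del: bernstein.simps)

lemma has_integral_gram:
  assumes "\<alpha>1 > -1" "\<alpha>2 > -1" "\<alpha>3 > -1" "k \<in> Theta n" "l \<in> Theta n"
  shows "has_bochner_integral lborel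
     (\<lambda>x. indicator triangle x *\<^sub>R (weight (\<alpha>1, \<alpha>2, \<alpha>3) x * bernstein n k x * bernstein n l x))
     (gram n (\<alpha>1, \<alpha>2, \<alpha>3) k l)"
proof -
  obtain i j m where l: "l = (int i, int j)" "n = i + j + m"
    using assms(5) by (rule Theta_cases)
  obtain i' j' m' where k: "k = (int i', int j')" "n = i' + j' + m'"
    using assms(4) by (rule Theta_cases)
  show ?thesis
    unfolding k(1) l(1) gram_nat[OF assms(1-3) l(2) k(2)]
    by (rule has_integral_bernstein_product[OF assms(1-3) l(2) k(2)])
qed

lemma inner_prod_bernstein_combination:
  assumes "\<alpha>1 > -1" "\<alpha>2 > -1" "\<alpha>3 > -1" "l \<in> Theta n"
  shows "inner_prod (\<alpha>1, \<alpha>2, \<alpha>3) (\<lambda>x. \<Sum>m\<in>Theta n. c m * bernstein n m x) (bernstein n l)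
     = (\<Sum>m\<in>Theta n. c m * gram n (\<alpha>1, \<alpha>2, \<alpha>3) m l)"
proof -
  have "has_bochner_integral lborel
     (\<lambda>x. \<Sum>m\<in>Theta n. c m * (indicator triangle x *\<^sub>R
        (weight (\<alpha>1, \<alpha>2, \<alpha>3) x * bernstein n m x * bernstein n l x)))
     (\<Sum>m\<in>Theta n. c m * gram n (\<alpha>1, \<alpha>2, \<alpha>3) m l)"
    by (intro has_bochner_integral_sum has_bochner_integral_mult_right has_integral_gram assms)
  also have "(\<lambda>x. \<Sum>m\<in>Theta n. c m * (indicator triangle x *\<^sub>R
        (weight (\<alpha>1, \<alpha>2, \<alpha>3) x * bernstein n m x * bernstein n l x)))
    = (\<lambda>x. indicator triangle x *\<^sub>R (weight (\<alpha>1, \<alpha>2, \<alpha>3) x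
        * (\<Sum>m\<in>Theta n. c m * bernstein n m x) * bernstein n l x))"
    by (simp add: fun_eq_iff sum_distrib_left sum_distrib_right mult_ac
        del: bernstein.simps weight.simps)
  finally show ?thesis
    unfolding inner_prod_def set_lebesgue_integral_def by (rule has_bochner_integral_integral_eq)
qed

text \<open>
  The points of \<open>U\<close> where \<open>f\<close> does not vanish form an open null set, which must be empty.
\<close>

lemma AE_zero_imp_zero_on_open:
  fixes f :: "'a::euclidean_space \<Rightarrow> real"
  assumes "open U" "continuous_on U f" "AE x in lborel. x \<in> U \<longrightarrow> f x = 0" "x \<in> U"
  shows "f x = 0"
proof (rule ccontr)
  assume "f x \<noteq> 0"
  define V where "V = U \<inter> f -` (- {0})"
  have "open V"
    unfolding V_def using assms(1,2) by (intro continuous_open_preimage) auto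
  have "AE x in lborel. x \<notin> V"
    using assms(3) by eventually_elim (auto simp: V_def)
  then have "V \<in> null_sets lborel"
    using \<open>open V\<close> by (subst AE_iff_null_sets) auto
  then have "negligible V"
    using negligible_iff_null_sets null_sets_completionI by blast
  then show False
    using open_not_negligible[OF \<open>open V\<close>] \<open>f x \<noteq> 0\<close> \<open>x \<in> U\<close> by (auto simp: V_def)
qed

lemma continuous_on_bernstein:
  assumes "k \<in> Theta n"
  shows "continuous_on A (bernstein n k)"
proof -
  obtain i j m where k: "k = (int i, int j)" "n = i + j + m"
    using assms by (rule Theta_cases)
  have "continuous_on A
      (\<lambda>x. multinom i j m * fst x ^ i * snd x ^ j * (1 - (fst x + snd x)) ^ m)"
    by (intro continuous_intros)
  then show ?thesis
    unfolding k by (simp only: bernstein_nat[abs_def] cong: continuous_on_cong)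
qed

lemma weight_pos:
  assumes "\<alpha>1 > -1" "\<alpha>2 > -1" "\<alpha>3 > -1" "0 < fst x" "0 < snd x" "fst x + snd x < 1"
  shows "weight (\<alpha>1, \<alpha>2, \<alpha>3) x > 0"
  using assms by (cases x) (simp add: Gamma_real_pos)

lemma weight_nonneg:
  assumes "\<alpha>1 > -1" "\<alpha>2 > -1" "\<alpha>3 > -1"
  shows "weight (\<alpha>1, \<alpha>2, \<alpha>3) x \<ge> 0"
  using assms by (cases x) (simp add: Gamma_real_pos less_imp_le)

text \<open>
  The quadratic form at \<open>c\<close> is the integral of the weight times the square of \<open>p = \<Sum>c\<^sub>k B\<^sub>k\<close>. If it
  vanishes, then so does \<open>p\<close> almost everywhere, hence by continuity on the whole interior of the
  triangle, where the weight is positive.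
\<close>

theorem gram_anisotropic:
  assumes "\<alpha>1 > -1" "\<alpha>2 > -1" "\<alpha>3 > -1"
  shows "anisotropic_on (Theta n) (gram n (\<alpha>1, \<alpha>2, \<alpha>3))"
  unfolding anisotropic_on_def
proof (intro allI impI ballI)
  fix c k
  let ?\<alpha> = "(\<alpha>1, \<alpha>2, \<alpha>3)"
  assume 0: "(\<Sum>k\<in>Theta n. \<Sum>l\<in>Theta n. c k * gram n ?\<alpha> k l * c l) = 0" and k: "k \<in> Theta n"
  define p where "p = (\<lambda>x. \<Sum>k\<in>Theta n. c k * bernstein n k x)"
  define f where "f = (\<lambda>x. indicator triangle x * (weight ?\<alpha> x * (p x)\<^sup>2))"
  have "has_bochner_integral lborel
      (\<lambda>x. \<Sum>k\<in>Theta n. \<Sum>l\<in>Theta n. c k * (indicator triangle x *\<^sub>R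
         (weight ?\<alpha> x * bernstein n k x * bernstein n l x)) * c l)
      (\<Sum>k\<in>Theta n. \<Sum>l\<in>Theta n. c k * gram n ?\<alpha> k l * c l)"
    by (intro has_bochner_integral_sum has_bochner_integral_mult_right
        has_bochner_integral_mult_left has_integral_gram assms)
  also have "(\<lambda>x. \<Sum>k\<in>Theta n. \<Sum>l\<in>Theta n. c k * (indicator triangle x *\<^sub>R
         (weight ?\<alpha> x * bernstein n k x * bernstein n l x)) * c l) = f"
    by (simp add: f_def p_def power2_eq_square sum_product sum_distrib_left fun_eq_iff mult_ac
        del: bernstein.simps weight.simps)
  finally have f: "has_bochner_integral lborel f 0" by (simp only: 0)
  have "f x \<ge> 0" for x
    using weight_nonneg[OF assms, of x] by (simp add: f_def del: weight.simps)
  then have "AE x in lborel. f x = 0"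
    using f integral_nonneg_eq_0_iff_AE[of lborel f] by (simp add: has_bochner_integral_iff)
  moreover define U where "U = {x :: real \<times> real. 0 < fst x \<and> 0 < snd x \<and> fst x + snd x < 1}"
  ultimately have "AE x in lborel. x \<in> U \<longrightarrow> p x = 0"
  proof eventually_elim
    case (elim x)
    have "weight ?\<alpha> x > 0" "x \<in> triangle"
      using weight_pos[OF assms, of x] elim by (auto simp: U_def triangle_def)
    then show ?case using elim by (simp add: f_def del: weight.simps)
  qed
  moreover have "open U"
    unfolding U_def by (intro open_Collect_conj open_Collect_less continuous_intros)
  moreover have "continuous_on U p"
    unfolding p_def by (intro continuous_intros continuous_on_bernstein)
  ultimately have "p x = 0" if "x \<in> U" for x
    using AE_zero_imp_zero_on_open that by blast
  then show "c k = 0"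
    using k by (intro bernstein_independent[where n = n and c = c]) (auto simp: p_def U_def simp del: bernstein.simps)
qed

text \<open>
  Existence in the two descriptions is evident from the rows of \<open>E\<close>. Uniqueness of the dual
  polynomial holds because a competitor is again a combination of Bernstein polynomials, whose
  coefficients form a row of a left inverse; uniqueness of its coefficients is linear independence.
\<close>

lemma
  assumes "\<alpha>1 > -1" "\<alpha>2 > -1" "\<alpha>3 > -1"
    and E: "left_inverse_on (Theta n) E (gram n (\<alpha>1, \<alpha>2, \<alpha>3))" and k: "k \<in> Theta n"
  shows dual_bernstein_eq_left_inverse:
      "dual_bernstein n (\<alpha>1, \<alpha>2, \<alpha>3) k = (\<lambda>x. \<Sum>m\<in>Theta n. E k m * bernstein n m x)"
    and bezier_coeff_eq_left_inverse:
      "bezier_coeff n (\<alpha>1, \<alpha>2, \<alpha>3) k = (\<lambda>l. if l \<in> Theta n then E k l else 0)"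
proof -
  let ?\<alpha> = "(\<alpha>1, \<alpha>2, \<alpha>3)"
  let ?d = "\<lambda>x. \<Sum>m\<in>Theta n. E k m * bernstein n m x"
  show dual: "dual_bernstein n ?\<alpha> k = ?d"
    unfolding dual_bernstein_def
  proof (rule the_equality, intro conjI ballI)
    show "?d \<in> Pi2 n"
      unfolding Pi2_eq_bernstein_span by (rule fspanI) (rule refl)
    show "inner_prod ?\<alpha> ?d (bernstein n l) = (if k = l then 1 else 0)" if "l \<in> Theta n" for l
      using E k that
      by (simp add: inner_prod_bernstein_combination[OF assms(1-3)] left_inverse_on_def
          del: bernstein.simps)
  next
    fix q
    assume q: "q \<in> Pi2 n \<and>
      (\<forall>l\<in>Theta n. inner_prod ?\<alpha> q (bernstein n l) = (if k = l then 1 else 0))"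
    then obtain c where c: "q = (\<lambda>x. \<Sum>m\<in>Theta n. c m * bernstein n m x)"
      unfolding Pi2_eq_bernstein_span fspan_def by blast
    have "(\<Sum>m\<in>Theta n. c m * gram n ?\<alpha> m l) = (if k = l then 1 else 0)" if "l \<in> Theta n" for l
      using q that inner_prod_bernstein_combination[OF assms(1-3) that, of c]
      by (simp add: c del: bernstein.simps)
    then have "c m = E k m" if "m \<in> Theta n" for m
      using anisotropic_left_inverse_unique[OF finite_Theta gram_anisotropic[OF assms(1-3)] E _ k that]
      by blast
    then show "q = ?d"
      unfolding c by (intro ext sum.cong refl) simp
  qed
  show "bezier_coeff n ?\<alpha> k = (\<lambda>l. if l \<in> Theta n then E k l else 0)"
    unfolding bezier_coeff_def dual if_P[OF k]
  proof (rule the_equality, intro conjI allI impI)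
    fix x
    show "?d x = (\<Sum>l\<in>Theta n. (if l \<in> Theta n then E k l else 0) * bernstein n l x)"
      by (intro sum.cong refl) simp
  next
    fix c
    assume c: "(\<forall>x. ?d x = (\<Sum>l\<in>Theta n. c l * bernstein n l x)) \<and> (\<forall>l. l \<notin> Theta n \<longrightarrow> c l = 0)"
    have "c l - E k l = 0" if "l \<in> Theta n" for l
    proof (rule bernstein_independent[OF _ that])
      fix x
      have "(\<Sum>l\<in>Theta n. (c l - E k l) * bernstein n l x)
          = (\<Sum>l\<in>Theta n. c l * bernstein n l x) - ?d x"
        by (simp add: left_diff_distrib sum_subtractf del: bernstein.simps)
      then show "(\<Sum>l\<in>Theta n. (c l - E k l) * bernstein n l x) = 0"
        using c by simp
    qed
    then show "c = (\<lambda>l. if l \<in> Theta n then E k l else 0)"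
      using c by auto
  qed simp
qed

theorem bezier_coeff_left_inverse:
  assumes "\<alpha>1 > -1" "\<alpha>2 > -1" "\<alpha>3 > -1"
  shows "left_inverse_on (Theta n) (bezier_coeff n (\<alpha>1, \<alpha>2, \<alpha>3)) (gram n (\<alpha>1, \<alpha>2, \<alpha>3))"
proof -
  obtain E where E: "left_inverse_on (Theta n) E (gram n (\<alpha>1, \<alpha>2, \<alpha>3))"
    using anisotropic_left_inverse_exists[OF finite_Theta gram_anisotropic[OF assms]] by blast
  then show ?thesis
    by (simp add: left_inverse_on_def bezier_coeff_eq_left_inverse[OF assms E])
qed

lemma bezier_coeff_outside:
  assumes "\<alpha>1 > -1" "\<alpha>2 > -1" "\<alpha>3 > -1" "k \<notin> Theta n \<or> l \<notin> Theta n"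
  shows "bezier_coeff n (\<alpha>1, \<alpha>2, \<alpha>3) k l = 0"
proof (cases "k \<in> Theta n")
  case True
  then show ?thesis
    using bezier_coeff_eq_left_inverse[OF assms(1-3) bezier_coeff_left_inverse[OF assms(1-3)] True]
      assms(4) by (metis (no_types, lifting))
qed (simp add: bezier_coeff_def)

section \<open>The recurrence relations\<close>

text \<open>
  The matrix \<open>M\<close> for which \<open>M f\<close> is the three-term combination of the values of \<open>f\<close> at \<open>k + (0, 1)\<close>,
  \<open>k\<close> and \<open>k - (0, 1)\<close>. Written as a sum of three diagonals, it can be summed along rows and along
  columns in the same manner.
\<close>

definition shift_matrix :: "nat \<Rightarrow> real \<times> real \<times> real \<Rightarrow> int \<times> int \<Rightarrow> int \<times> int \<Rightarrow> real" where
  "shift_matrix n \<alpha> k m =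
     (if m = k + (0, 1) then phi0 n \<alpha> k else 0) - (if m = k then phi1 n \<alpha> k else 0)
     + (if m = k - (0, 1) then phi2 n \<alpha> k else 0)"

lemma shift_matrix_row_sum:
  assumes "\<And>m. m \<notin> Theta n \<Longrightarrow> f m = 0"
  shows "(\<Sum>m\<in>Theta n. shift_matrix n \<alpha> k m * f m)
    = phi0 n \<alpha> k * f (k + (0, 1)) - phi1 n \<alpha> k * f k + phi2 n \<alpha> k * f (k - (0, 1))"
proof -
  have pick: "(\<Sum>m\<in>Theta n. (if m = p then a else 0) * f m) = a * f p" for p and a :: real
    using assms[of p] finite_Theta[of n] by (simp add: if_distrib[of "\<lambda>u. u * _"] cong: if_cong)
  show ?thesis
    unfolding shift_matrix_def left_diff_distrib distrib_right sum.distrib sum_subtractf pick ..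
qed

lemma shift_matrix_column_sum:
  assumes "\<And>m. m \<notin> Theta n \<Longrightarrow> f m = 0"
  shows "(\<Sum>m\<in>Theta n. f m * shift_matrix n \<alpha> m l)
    = phi0 n \<alpha> (l - (0, 1)) * f (l - (0, 1)) - phi1 n \<alpha> l * f l + phi2 n \<alpha> (l + (0, 1)) * f (l + (0, 1))"
proof -
  have pick: "(\<Sum>m\<in>Theta n. f m * (if m = p then a m else 0)) = a p * f p"
    for p and a :: "int \<times> int \<Rightarrow> real"
  proof -
    have "(\<Sum>m\<in>Theta n. f m * (if m = p then a m else 0)) = (\<Sum>m\<in>Theta n. if m = p then a p * f p else 0)"
      by (intro sum.cong refl) simp
    then show ?thesis using assms[of p] finite_Theta[of n] by simp
  qed
  have "shift_matrix n \<alpha> m l = (if m = l - (0, 1) then phi0 n \<alpha> m else 0)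
     - (if m = l then phi1 n \<alpha> m else 0) + (if m = l + (0, 1) then phi2 n \<alpha> m else 0)" for m
    unfolding shift_matrix_def by (cases m; cases l) auto
  then show ?thesis
    by (simp only: right_diff_distrib distrib_left sum.distrib sum_subtractf pick)
qed

lemma Gamma_plus1_pos: "Gamma (x + 1) = x * Gamma x" if "x > 0" for x :: real
  using that by (intro Gamma_plus1) (auto elim!: nonpos_Ints_cases)

text \<open>
  Moving one unit of the exponent from the second to the third barycentric coordinate changes an
  entry of the Gram matrix by the recurrences of the factorial and the Gamma function only.
\<close>

lemma gram_shift:
  assumes \<alpha>: "\<alpha>1 > -1" "\<alpha>2 > -1" "\<alpha>3 > -1"
    and n: "n = i + Suc j + m" "n = i' + j' + m'"
  shows "real (Suc j) * (\<alpha>3 + real (m + m') + 1)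
        * gram n (\<alpha>1, \<alpha>2, \<alpha>3) (int i', int j') (int i, int (Suc j))
      = real (Suc m) * (\<alpha>2 + real (j + j') + 1)
        * gram n (\<alpha>1, \<alpha>2, \<alpha>3) (int i', int j') (int i, int j)"
proof -
  have n': "n = i + j + Suc m" using n by simp
  have mult: "real (Suc j) * multinom i (Suc j) m = real (Suc m) * multinom i j (Suc m)"
    using multinom_Suc(2,3)[of i j m] by (simp only: mult.commute)
  have g2: "Gamma (\<alpha>2 + real (Suc j + j') + 1)
      = (\<alpha>2 + real (j + j') + 1) * Gamma (\<alpha>2 + real (j + j') + 1)"
  proof -
    have "\<alpha>2 + real (Suc j + j') + 1 = (\<alpha>2 + real (j + j') + 1) + 1" by simp
    moreover have "\<alpha>2 + real (j + j') + 1 > 0" using \<alpha> by linarith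
    ultimately show ?thesis by (simp only: Gamma_plus1_pos)
  qed
  have g3: "Gamma (\<alpha>3 + real (Suc m + m') + 1)
      = (\<alpha>3 + real (m + m') + 1) * Gamma (\<alpha>3 + real (m + m') + 1)"
  proof -
    have "\<alpha>3 + real (Suc m + m') + 1 = (\<alpha>3 + real (m + m') + 1) + 1" by simp
    moreover have "\<alpha>3 + real (m + m') + 1 > 0" using \<alpha> by linarith
    ultimately show ?thesis by (simp only: Gamma_plus1_pos)
  qed
  define K where "K = weight_const \<alpha>1 \<alpha>2 \<alpha>3 * multinom i' j' m' * Gamma (\<alpha>1 + real (i + i') + 1)
     * Gamma (\<alpha>2 + real (j + j') + 1) * Gamma (\<alpha>3 + real (m + m') + 1)
     / Gamma (\<alpha>1 + \<alpha>2 + \<alpha>3 + real (2 * n) + 3)"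
  have "gram n (\<alpha>1, \<alpha>2, \<alpha>3) (int i', int j') (int i, int (Suc j))
      = K * (multinom i (Suc j) m * (\<alpha>2 + real (j + j') + 1))"
    unfolding gram_nat[OF \<alpha> n] g2 K_def by (simp only: mult_ac times_divide_eq_right)
  moreover have "gram n (\<alpha>1, \<alpha>2, \<alpha>3) (int i', int j') (int i, int j)
      = K * (multinom i j (Suc m) * (\<alpha>3 + real (m + m') + 1))"
    unfolding gram_nat[OF \<alpha> n' n(2)] g3 K_def by (simp only: mult_ac times_divide_eq_right)
  moreover have "real (Suc j) * c * (K * (multinom i (Suc j) m * b))
      = real (Suc m) * b * (K * (multinom i j (Suc m) * c))" for b c
  proof -
    have "real (Suc j) * c * (K * (multinom i (Suc j) m * b))
        = (real (Suc j) * multinom i (Suc j) m) * (b * c * K)" by (simp only: mult_ac)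
    also have "\<dots> = real (Suc m) * b * (K * (multinom i j (Suc m) * c))"
      unfolding mult by (simp only: mult_ac)
    finally show ?thesis .
  qed
  ultimately show ?thesis by (simp only:)
qed

text \<open>
  The continuation by zero in the second index lets the sums over a column of the shift matrix be
  written without regard to whether the shifted indices stay in \<open>Theta n\<close>.
\<close>

definition gram0 :: "nat \<Rightarrow> real \<times> real \<times> real \<Rightarrow> int \<times> int \<Rightarrow> int \<times> int \<Rightarrow> real" where
  "gram0 n \<alpha> k l = (if l \<in> Theta n then gram n \<alpha> k l else 0)"

text \<open>
  For \<open>j = 0\<close> the shifted index leaves \<open>Theta n\<close> and both sides vanish. The factor \<open>\<alpha>2 + j + j'\<close> stays on
  the left because it can be zero, namely for \<open>\<alpha>2 = 0\<close> and \<open>j = j' = 0\<close>.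
\<close>

lemma gram0_down:
  assumes \<alpha>: "\<alpha>1 > -1" "\<alpha>2 > -1" "\<alpha>3 > -1"
    and n: "n = i + j + m" "n = i' + j' + m'"
  shows "phi0 n (\<alpha>1, \<alpha>2, \<alpha>3) ((int i, int j) - (0, 1))
        * gram0 n (\<alpha>1, \<alpha>2, \<alpha>3) (int i', int j') ((int i, int j) - (0, 1)) * (\<alpha>2 + real j + real j')
      = - (real j * (real j + \<alpha>2) * (\<alpha>3 + real m + real m' + 1)
        * gram n (\<alpha>1, \<alpha>2, \<alpha>3) (int i', int j') (int i, int j))"
proof (cases j)
  case 0
  then show ?thesis by (simp add: gram0_def Theta_def)
next
  case (Suc j0)
  let ?g = "gram n (\<alpha>1, \<alpha>2, \<alpha>3) (int i', int j')"
  have idx: "(int i, int j) - (0, 1) = (int i, int j0)" using Suc by simp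
  have in_Theta: "(int i, int j0) \<in> Theta n" using n Suc by (simp add: Theta_nat_iff)
  have phi: "phi0 n (\<alpha>1, \<alpha>2, \<alpha>3) (int i, int j0) = - (real (Suc m) * (real j + \<alpha>2))"
    using Suc n(1) by (simp add: algebra_simps)
  have shift: "real j * (\<alpha>3 + real (m + m') + 1) * ?g (int i, int j)
      = real (Suc m) * (\<alpha>2 + real (j0 + j') + 1) * ?g (int i, int j0)"
    using gram_shift[OF \<alpha>, of n i j0 m i' j' m'] n Suc by simp
  have "phi0 n (\<alpha>1, \<alpha>2, \<alpha>3) (int i, int j0) * ?g (int i, int j0) * (\<alpha>2 + real j + real j')
      = - ((real j + \<alpha>2) * (real (Suc m) * (\<alpha>2 + real (j0 + j') + 1) * ?g (int i, int j0)))"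
    unfolding phi using Suc by (simp add: algebra_simps)
  also have "\<dots> = - ((real j + \<alpha>2) * (real j * (\<alpha>3 + real (m + m') + 1) * ?g (int i, int j)))"
    by (simp only: shift)
  finally show ?thesis
    unfolding idx gram0_def if_P[OF in_Theta] by (simp add: mult_ac add.assoc)
qed

lemma gram0_up:
  assumes \<alpha>: "\<alpha>1 > -1" "\<alpha>2 > -1" "\<alpha>3 > -1"
    and n: "n = i + j + m" "n = i' + j' + m'"
  shows "phi2 n (\<alpha>1, \<alpha>2, \<alpha>3) ((int i, int j) + (0, 1))
        * gram0 n (\<alpha>1, \<alpha>2, \<alpha>3) (int i', int j') ((int i, int j) + (0, 1)) * (\<alpha>3 + real m + real m')
      = - (real m * (real m + \<alpha>3) * (\<alpha>2 + real j + real j' + 1)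
        * gram n (\<alpha>1, \<alpha>2, \<alpha>3) (int i', int j') (int i, int j))"
proof (cases m)
  case 0
  then show ?thesis using n(1) by (simp add: gram0_def Theta_def)
next
  case (Suc m0)
  let ?g = "gram n (\<alpha>1, \<alpha>2, \<alpha>3) (int i', int j')"
  have idx: "(int i, int j) + (0, 1) = (int i, int (Suc j))" by simp
  have in_Theta: "(int i, int (Suc j)) \<in> Theta n" unfolding Theta_nat_iff using n Suc by simp
  have phi: "phi2 n (\<alpha>1, \<alpha>2, \<alpha>3) (int i, int (Suc j)) = - (real (Suc j) * (real m + \<alpha>3))"
    using Suc n(1) by (simp add: algebra_simps)
  have shift: "real (Suc j) * (\<alpha>3 + real (m0 + m') + 1) * ?g (int i, int (Suc j))
      = real m * (\<alpha>2 + real (j + j') + 1) * ?g (int i, int j)"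
    using gram_shift[OF \<alpha>, of n i j m0 i' j' m'] n Suc by simp
  have "phi2 n (\<alpha>1, \<alpha>2, \<alpha>3) (int i, int (Suc j)) * ?g (int i, int (Suc j)) * (\<alpha>3 + real m + real m')
      = - ((real m + \<alpha>3) * (real (Suc j) * (\<alpha>3 + real (m0 + m') + 1) * ?g (int i, int (Suc j))))"
    unfolding phi using Suc by (simp add: algebra_simps)
  also have "\<dots> = - ((real m + \<alpha>3) * (real m * (\<alpha>2 + real (j + j') + 1) * ?g (int i, int j)))"
    by (simp only: shift)
  finally show ?thesis
    unfolding idx gram0_def if_P[OF in_Theta] by (simp add: mult_ac add.assoc)
qed

text \<open>
  From \<open>p (p + a) - q (q + a) = (p - q) (a + p + q)\<close>: in the difference of two shifted terms with \<open>k\<close>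
  and \<open>l\<close> exchanged, the denominator \<open>a + p + q\<close> left by the Gamma function cancels. As \<open>a > -1\<close>, it is
  zero only if \<open>p = q = 0\<close>, and then both terms are zero.
\<close>

lemma antisymmetric_part:
  fixes a :: real and p q :: nat
  assumes "a > -1"
    and X: "X * (a + real p + real q) = - (real p * (real p + a) * d * g)"
    and Y: "Y * (a + real q + real p) = - (real q * (real q + a) * d * g)"
    and zero: "p = 0 \<Longrightarrow> X = 0" "q = 0 \<Longrightarrow> Y = 0"
  shows "X - Y = - ((real p - real q) * d * g)"
proof (cases "a + real p + real q = 0")
  case True
  then have "p = 0" "q = 0" using assms(1) by linarith+
  then show ?thesis using zero by simp
next
  case False
  have "(X - Y) * (a + real p + real q) = - ((real p - real q) * d * g) * (a + real p + real q)"
    using X Y by (simp add: algebra_simps)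
  then show ?thesis by (rule mult_right_cancel[OF False, THEN iffD1])
qed

text \<open>
  Write \<open>j\<close>, \<open>m\<close> for the second and third exponent of \<open>l\<close>, and \<open>j'\<close>, \<open>m'\<close> for those of \<open>k\<close>. The
  antisymmetric parts of the two shifted terms are \<open>(j' - j) (\<alpha>3 + m + m' + 1) G\<close> and
  \<open>(m' - m) (\<alpha>2 + j + j' + 1) G\<close>, where \<open>G\<close> is the entry at \<open>(k, l)\<close>; their sum cancels the
  antisymmetric part of the diagonal term.
\<close>

lemma gram_shift_self_adjoint:
  assumes \<alpha>: "\<alpha>1 > -1" "\<alpha>2 > -1" "\<alpha>3 > -1"
    and k: "k \<in> Theta n" and l: "l \<in> Theta n"
  shows "(\<Sum>m\<in>Theta n. gram n (\<alpha>1, \<alpha>2, \<alpha>3) k m * shift_matrix n (\<alpha>1, \<alpha>2, \<alpha>3) m l)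
       = (\<Sum>m\<in>Theta n. gram n (\<alpha>1, \<alpha>2, \<alpha>3) l m * shift_matrix n (\<alpha>1, \<alpha>2, \<alpha>3) m k)"
proof -
  let ?\<alpha> = "(\<alpha>1, \<alpha>2, \<alpha>3)"
  obtain i j m where l_eq: "l = (int i, int j)" and n: "n = i + j + m"
    using l by (rule Theta_cases)
  obtain i' j' m' where k_eq: "k = (int i', int j')" and n': "n = i' + j' + m'"
    using k by (rule Theta_cases)
  let ?down = "\<lambda>k l. phi0 n ?\<alpha> (l - (0, 1)) * gram0 n ?\<alpha> k (l - (0, 1))"
  let ?up = "\<lambda>k l. phi2 n ?\<alpha> (l + (0, 1)) * gram0 n ?\<alpha> k (l + (0, 1))"
  define g where "g = gram n ?\<alpha> k l"
  have expand: "(\<Sum>m\<in>Theta n. gram n ?\<alpha> k m * shift_matrix n ?\<alpha> m l)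
      = ?down k l - phi1 n ?\<alpha> l * gram n ?\<alpha> k l + ?up k l" if "l \<in> Theta n" for k l
  proof -
    have "(\<Sum>m\<in>Theta n. gram n ?\<alpha> k m * shift_matrix n ?\<alpha> m l)
        = (\<Sum>m\<in>Theta n. gram0 n ?\<alpha> k m * shift_matrix n ?\<alpha> m l)"
      by (intro sum.cong refl) (simp add: gram0_def)
    also have "\<dots> = ?down k l - phi1 n ?\<alpha> l * gram0 n ?\<alpha> k l + ?up k l"
      by (rule shift_matrix_column_sum) (simp add: gram0_def)
    finally show ?thesis using that by (simp add: gram0_def)
  qed
  have g_lk: "gram n ?\<alpha> l k = g" using gram_sym g_def by simp
  have D: "?down k l - ?down l k = - ((real j - real j') * (\<alpha>3 + real m + real m' + 1) * g)"
  proof (rule antisymmetric_part[OF \<alpha>(2)])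
    show "?down k l * (\<alpha>2 + real j + real j')
        = - (real j * (real j + \<alpha>2) * (\<alpha>3 + real m + real m' + 1) * g)"
      using gram0_down[OF \<alpha> n n'] by (simp only: l_eq k_eq g_def)
    show "?down l k * (\<alpha>2 + real j' + real j)
        = - (real j' * (real j' + \<alpha>2) * (\<alpha>3 + real m + real m' + 1) * g)"
      using gram0_down[OF \<alpha> n' n] unfolding g_lk[unfolded l_eq k_eq]
      by (simp only: l_eq k_eq add_ac)
  qed (simp_all add: l_eq k_eq gram0_def Theta_def)
  have U: "?up k l - ?up l k = - ((real m - real m') * (\<alpha>2 + real j + real j' + 1) * g)"
  proof (rule antisymmetric_part[OF \<alpha>(3)])
    show "?up k l * (\<alpha>3 + real m + real m')
        = - (real m * (real m + \<alpha>3) * (\<alpha>2 + real j + real j' + 1) * g)"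
      using gram0_up[OF \<alpha> n n'] by (simp only: l_eq k_eq g_def)
    show "?up l k * (\<alpha>3 + real m' + real m)
        = - (real m' * (real m' + \<alpha>3) * (\<alpha>2 + real j + real j' + 1) * g)"
      using gram0_up[OF \<alpha> n' n] unfolding g_lk[unfolded l_eq k_eq]
      by (simp only: l_eq k_eq add_ac)
    show "?up k l = 0" if "m = 0" using that n by (simp add: l_eq gram0_def Theta_def)
    show "?up l k = 0" if "m' = 0" using that n' by (simp add: k_eq gram0_def Theta_def)
  qed
  have phi1: "phi1 n ?\<alpha> l = - (real m * (real j + \<alpha>2 + 1)) - real j * (real m + \<alpha>3 + 1)"
    unfolding phi1_def l_eq using n by (simp add: algebra_simps)
  have phi1': "phi1 n ?\<alpha> k = - (real m' * (real j' + \<alpha>2 + 1)) - real j' * (real m' + \<alpha>3 + 1)"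
    unfolding phi1_def k_eq using n' by (simp add: algebra_simps)
  have "?down k l - phi1 n ?\<alpha> l * g + ?up k l = ?down l k - phi1 n ?\<alpha> k * g + ?up l k"
  proof -
    have "phi1 n ?\<alpha> l * g - phi1 n ?\<alpha> k * g
        = - ((real j - real j') * (\<alpha>3 + real m + real m' + 1) * g)
          - ((real m - real m') * (\<alpha>2 + real j + real j' + 1) * g)"
      unfolding phi1 phi1' by (simp add: algebra_simps)
    then show ?thesis using D U by linarith
  qed
  then show ?thesis
    unfolding expand[OF l] expand[OF k] g_lk g_def[symmetric] .
qed

theorem bezier_coeff_recurrence:
  assumes \<alpha>: "\<alpha>1 > -1" "\<alpha>2 > -1" "\<alpha>3 > -1"
    and k: "k \<in> Theta n" and l: "l \<in> Theta n"
  defines "e \<equiv> bezier_coeff n (\<alpha>1, \<alpha>2, \<alpha>3)"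
  shows "phi0 n (\<alpha>1, \<alpha>2, \<alpha>3) k * e (k + (0, 1)) l - phi1 n (\<alpha>1, \<alpha>2, \<alpha>3) k * e k l
         + phi2 n (\<alpha>1, \<alpha>2, \<alpha>3) k * e (k - (0, 1)) l
       = phi0 n (\<alpha>1, \<alpha>2, \<alpha>3) l * e k (l + (0, 1)) - phi1 n (\<alpha>1, \<alpha>2, \<alpha>3) l * e k l
         + phi2 n (\<alpha>1, \<alpha>2, \<alpha>3) l * e k (l - (0, 1))"
proof -
  let ?M = "shift_matrix n (\<alpha>1, \<alpha>2, \<alpha>3)"
  have "(\<Sum>m\<in>Theta n. ?M k m * e m l) = (\<Sum>m\<in>Theta n. ?M l m * e k m)"
    unfolding e_def
    by (rule self_adjoint_imp_inverse_intertwines[OF finite_Theta bezier_coeff_left_inverse[OF \<alpha>]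
          gram_sym gram_shift_self_adjoint[OF \<alpha>] k l])
  moreover have "e p q = 0" if "p \<notin> Theta n \<or> q \<notin> Theta n" for p q
    unfolding e_def using that by (rule bezier_coeff_outside[OF \<alpha>])
  ultimately show ?thesis
    using shift_matrix_row_sum[of n "\<lambda>m. e m l"] shift_matrix_row_sum[of n "e k"] by simp
qed

lemma swap_mem_Theta_iff: "prod.swap k \<in> Theta n \<longleftrightarrow> k \<in> Theta n"
  by (cases k) (auto simp: Theta_def add.commute)

lemma sum_Theta_swap: "(\<Sum>k\<in>Theta n. f (prod.swap k)) = (\<Sum>k\<in>Theta n. f k :: real)"
  by (rule sum.reindex_bij_witness[where i = prod.swap and j = prod.swap])
     (simp_all add: swap_mem_Theta_iff)

lemma gram_swap:
  assumes \<alpha>: "\<alpha>1 > -1" "\<alpha>2 > -1" "\<alpha>3 > -1" and "k \<in> Theta n" "l \<in> Theta n"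
  shows "gram n (\<alpha>2, \<alpha>1, \<alpha>3) (prod.swap k) (prod.swap l) = gram n (\<alpha>1, \<alpha>2, \<alpha>3) k l"
proof -
  obtain i j m where l: "l = (int i, int j)" "n = i + j + m"
    using assms(5) by (rule Theta_cases)
  obtain i' j' m' where k: "k = (int i', int j')" "n = i' + j' + m'"
    using assms(4) by (rule Theta_cases)
  have n: "n = j + i + m" "n = j' + i' + m'" using k l by simp_all
  have multinom_swap: "multinom j i m = multinom i j m" for i j m
    by (simp add: multinom_def add_ac mult_ac)
  have wc: "weight_const \<alpha>2 \<alpha>1 \<alpha>3 = weight_const \<alpha>1 \<alpha>2 \<alpha>3" "\<alpha>2 + \<alpha>1 = \<alpha>1 + \<alpha>2"
    by (simp_all add: add_ac mult_ac)
  show ?thesis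
    unfolding k(1) l(1) swap_simp gram_nat[OF \<alpha> l(2) k(2)] gram_nat[OF \<alpha>(2,1,3) n]
      multinom_swap[of j i] multinom_swap[of j' i'] wc by (simp add: mult_ac)
qed

text \<open>
  The Gram matrix is invariant under the simultaneous exchange of the two variables in the indices
  and in the parameters; by uniqueness so is its inverse.
\<close>

lemma bezier_coeff_swap:
  assumes \<alpha>: "\<alpha>1 > -1" "\<alpha>2 > -1" "\<alpha>3 > -1"
  shows "bezier_coeff n (\<alpha>2, \<alpha>1, \<alpha>3) (prod.swap k) (prod.swap l) = bezier_coeff n (\<alpha>1, \<alpha>2, \<alpha>3) k l"
proof (cases "k \<in> Theta n \<and> l \<in> Theta n")
  case True
  let ?e = "bezier_coeff n (\<alpha>2, \<alpha>1, \<alpha>3)"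
  have "(\<Sum>m\<in>Theta n. ?e (prod.swap k) (prod.swap m) * gram n (\<alpha>1, \<alpha>2, \<alpha>3) m p)
      = (if k = p then 1 else 0)" if p: "p \<in> Theta n" for p
  proof -
    have "(\<Sum>m\<in>Theta n. ?e (prod.swap k) (prod.swap m) * gram n (\<alpha>1, \<alpha>2, \<alpha>3) m p)
        = (\<Sum>m\<in>Theta n. ?e (prod.swap k) (prod.swap m)
            * gram n (\<alpha>2, \<alpha>1, \<alpha>3) (prod.swap m) (prod.swap p))"
      by (intro sum.cong refl) (simp add: gram_swap[OF \<alpha> _ p])
    also have "\<dots> = (\<Sum>m\<in>Theta n. ?e (prod.swap k) m * gram n (\<alpha>2, \<alpha>1, \<alpha>3) m (prod.swap p))"
      by (rule sum_Theta_swap)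
    also have "\<dots> = (if prod.swap k = prod.swap p then 1 else 0)"
      using bezier_coeff_left_inverse[OF \<alpha>(2,1,3)] True p
      by (simp add: left_inverse_on_def swap_mem_Theta_iff)
    finally show ?thesis by (cases k; cases p) auto
  qed
  then show ?thesis
    using True
    by (intro anisotropic_left_inverse_unique[OF finite_Theta gram_anisotropic[OF \<alpha>]
          bezier_coeff_left_inverse[OF \<alpha>], where c = "\<lambda>m. ?e (prod.swap k) (prod.swap m)"]) auto
next
  case False
  then have "k \<notin> Theta n \<or> l \<notin> Theta n" "prod.swap k \<notin> Theta n \<or> prod.swap l \<notin> Theta n"
    by (simp_all add: swap_mem_Theta_iff)
  then show ?thesis
    by (simp only: bezier_coeff_outside[OF \<alpha>] bezier_coeff_outside[OF \<alpha>(2,1,3)])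
qed

theorem lemmaA3:
  fixes n :: nat and \<alpha>1 \<alpha>2 \<alpha>3 :: real and \<alpha> :: "real \<times> real \<times> real"
  assumes "\<alpha> = (\<alpha>1, \<alpha>2, \<alpha>3)" and "\<alpha>1 > -1" and "\<alpha>2 > -1" and "\<alpha>3 > -1"
  shows "\<forall>k\<in>Theta n. \<forall>l\<in>Theta n.
    (let e = bezier_coeff n \<alpha>; v1 = (1, 0); v2 = (0, 1) in
       sigma0 n \<alpha> k * e (k + v2) l - sigma1 n \<alpha> k * e k l + sigma2 n \<alpha> k * e (k - v2) l
       = sigma0 n \<alpha> l * e k (l + v2) - sigma1 n \<alpha> l * e k l + sigma2 n \<alpha> l * e k (l - v2)
     \<and> tau0 n \<alpha> k * e (k + v1) l - tau1 n \<alpha> k * e k l + tau2 n \<alpha> k * e (k - v1) l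
       = tau0 n \<alpha> l * e k (l + v1) - tau1 n \<alpha> l * e k l + tau2 n \<alpha> l * e k (l - v1))"
  unfolding Let_def
proof (intro ballI conjI)
  fix k l assume k: "k \<in> Theta n" and l: "l \<in> Theta n"
  let ?e = "bezier_coeff n \<alpha>"
  show "sigma0 n \<alpha> k * ?e (k + (0, 1)) l - sigma1 n \<alpha> k * ?e k l + sigma2 n \<alpha> k * ?e (k - (0, 1)) l
      = sigma0 n \<alpha> l * ?e k (l + (0, 1)) - sigma1 n \<alpha> l * ?e k l + sigma2 n \<alpha> l * ?e k (l - (0, 1))"
    unfolding assms(1) by (rule bezier_coeff_recurrence[OF assms(2-4) k l])
  have swap_shift: "prod.swap p + (0, 1) = prod.swap (p + (1, 0))"
    "prod.swap p - (0, 1) = prod.swap (p - (1, 0))" for p :: "int \<times> int"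
    by (cases p; simp)+
  show "tau0 n \<alpha> k * ?e (k + (1, 0)) l - tau1 n \<alpha> k * ?e k l + tau2 n \<alpha> k * ?e (k - (1, 0)) l
      = tau0 n \<alpha> l * ?e k (l + (1, 0)) - tau1 n \<alpha> l * ?e k l + tau2 n \<alpha> l * ?e k (l - (1, 0))"
    using bezier_coeff_recurrence[OF assms(3,2,4), of "prod.swap k" n "prod.swap l"] k l
    unfolding swap_shift swap_mem_Theta_iff bezier_coeff_swap[OF assms(2-4)]
      assms(1) tau0_def tau1_def tau2_def swap12.simps by blast
qed

end
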